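(* Let $\Phi$ be a simple stationary point process on $\mathbb R^d$ with non-degenerate intensity, with distribution $\mathcal P$ and Palm distribution $\mathcal P_0$, and let $f$ be a point-map with associated point-shift $F$. For $n\in\mathbb N$ and $\phi\in\mathbf N^0$ put $m^n_f(\phi):=m^n_f(\phi,0)=\phi(F^{-n}(\phi,0))$. Then for all $n$, $m^n_f(\phi)$ is $\mathcal P_0$-a.s. finite. Moreover, if there exists a unique $f$-probability $\mathcal P_0^f$ of $\mathcal P_0$, then for all measurable sets $G\subset\mathbf N^0$ such that $\mathcal P^{f,n}_0[G]\to\mathcal P_0^f[G]$ as $n\to\infty$, one has $$\mathcal P_0^f[G]=\lim_{n\to\infty}\mathcal E_0\left[\frac{m^n_f}{\mathcal E_0[m^n_f\mid m^n_f>0]}\,1_G\;\Big|\;m^n_f>0\right],$$ where $\mathcal E_0$ denotes expectation with respect to $\mathcal P_0$.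
   Context: $\mathbf N$ is the space of locally finite counting measures on $\mathbb R^d$ (not necessarily simple; identified with multisets), with the vague topology and its Borel $\sigma$-field $\mathcal N$. $\overline\phi$ is the support of $\phi$; $x\in\phi$ means $\phi(\{x\})>0$. $\mathbf N^0=\{\phi\in\mathbf N:0\in\phi\}$. For $t\in\mathbb R^d$, $\theta_t\phi(B)=\phi(B+t)$ (translation by $-t$). $\mathbf M^1(\mathbf N^0)$ is the set of probability measures on $\mathbf N^0$ with the topology of weak convergence. Point-map: a measurable $f:\mathbf N^0\to\mathbb R^d$ with $f(\phi)=f(\overline\phi)\in\overline\phi$ for all $\phi$. Its point-shift is $F(\phi,x)=f(\theta_x\phi)+x$ for $x\in\phi$. Iterates: $F^0(\phi,x)=x$, $F^{k+1}(\phi,x)=F(\phi,F^k(\phi,x))$; $F^{-n}(\phi,y)=\{x\in\phi:F^n(\phi,x)=y\}$. For $\phi\in\mathbf N^0$, $\theta_f(\phi)=\theta_{f(\phi)}\phi\in\mathbf N^0$, with $n$-th iterate $\theta_f^n$. For $y\in\phi$, $m_f^n(\phi,y)=\phi(F^{-n}(\phi,y))=\sum_{x\in F^{-n}(\phi,y)}\phi(\{x\})$ (empty sum $=0$). Stationary point process: $(\theta_t)_{t\in\mathbb R^d}$ is a measurable flow on a probability space $(\Omega,\mathcal F,\mathbb P)$ leaving $\mathbb P$ invariant, and $\Phi:\Omega\to\mathbf N$ is measurable with $\Phi\circ\theta_t=\theta_t\circ\Phi$. Its intensity $\lambda$ is the mean number of points (with multiplicity) in the unit cube; it is non-degenerate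 if $0<\lambda<\infty$. The Palm probability is $\mathbb P_\Phi[A]=\frac1{\lambda|B|}\int_\Omega\int_B\mathbf 1\{\theta_t\omega\in A\}\,\Phi(\omega,dt)\,\mathbb P[d\omega]$ for any Borel $B$ with Lebesgue measure $0<|B|<\infty$. $\mathcal P=\Phi_*\mathbb P$ is the distribution of $\Phi$ and $\mathcal P_0=\Phi_*\mathbb P_\Phi$ its Palm distribution, a probability on $\mathbf N^0$. Here $h_*\mu(A)=\mu(h^{-1}A)$. $n$-th image Palm probability: $\mathcal P_0^{f,n}=(\theta_f^n)_*\mathcal P_0$. An $f$-probability of $\mathcal P_0$ is any element of $\mathbf M^1(\mathbf N^0)$ which is a limit of $\mathcal P_0^{f,n_i}$ along some $n_1<n_2<\cdots$; if the whole sequence $(\mathcal P_0^{f,n})_n$ converges, its limit is called the $f$-probability of $\mathcal P_0$ and is denoted $\mathcal P_0^f$. Existence of a unique $f$-probability is understood as convergence of the sequence $(\mathcal P_0^{f,n})_n$ to $\mathcal P_0^f$. *)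

theory Defs
  imports "HOL-Probability.Probability"
begin

section \<open>Initial topologies\<close>

text \<open>The coarsest topology on the carrier \<open>S\<close> for which all functions in \<open>H\<close> are continuous.\<close>

definition initial_topology :: "'b set \<Rightarrow> ('b \<Rightarrow> real) set \<Rightarrow> 'b topology" where
  "initial_topology S H =
     topology_generated_by (insert S {{x \<in> S. h x \<in> U} | h U. h \<in> H \<and> open U})"

lemma topspace_initial_topology [simp]: "topspace (initial_topology S H) = S"
  by (auto simp: initial_topology_def topology_generated_by_topspace)

lemma continuous_map_initial_topology:
  assumes "h \<in> H"
  shows "continuous_map (initial_topology S H) euclideanreal h"
proof -
  have "openin (initial_topology S H) {x \<in> S. h x \<in> U}" if "open U" for U
    unfolding initial_topology_def using assms that
    by (intro topology_generated_by_Basis) auto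
  then show ?thesis
    by (auto simp: continuous_map)
qed

text \<open>Convergence in an initial topology is convergence under each of the functions in \<open>H\<close>.\<close>

lemma limitin_initial_topology:
  "limitin (initial_topology S H) X l F \<longleftrightarrow>
     l \<in> S \<and> (\<forall>\<^sub>F n in F. X n \<in> S) \<and> (\<forall>h\<in>H. ((\<lambda>n. h (X n)) \<longlongrightarrow> h l) F)"
    (is "?L \<longleftrightarrow> ?R")
proof
  assume L: ?L
  have "((\<lambda>n. h (X n)) \<longlongrightarrow> h l) F" if "h \<in> H" for h
    using continuous_map_limit[OF continuous_map_initial_topology[OF that] L]
    by (simp add: o_def)
  moreover have "\<forall>\<^sub>F n in F. X n \<in> S"
    using L openin_topspace[of "initial_topology S H"] unfolding limitin_def
    by simp
  ultimately show ?R
    using L by (auto simp: limitin_def)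
next
  assume R: ?R
  have "\<forall>\<^sub>F n in F. X n \<in> V"
    if "generate_topology_on (insert S {{x \<in> S. h x \<in> U} | h U. h \<in> H \<and> open U}) V" "l \<in> V" for V
    using that
  proof induction
    case (Int a b)
    then show ?case by (auto intro: eventually_conj)
  next
    case (UN K)
    then obtain k where "k \<in> K" "l \<in> k" by auto
    then have "\<forall>\<^sub>F n in F. X n \<in> k" by (rule UN.IH)
    then show ?case
      by (rule eventually_mono) (use \<open>k \<in> K\<close> in auto)
  next
    case (Basis V)
    then consider "V = S" | h U where "V = {x \<in> S. h x \<in> U}" "h \<in> H" "open U" by blast
    then show ?case
    proof cases
      case 1
      then show ?thesis using R by simp
    next
      case 2
      then have "\<forall>\<^sub>F n in F. h (X n) \<in> U"
        using R Basis.prems by (auto intro: topological_tendstoD)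
      then show ?thesis
        using R 2 by (auto elim: eventually_elim2)
    qed
  qed auto
  then show ?L
    using R by (auto simp: limitin_def initial_topology_def openin_topology_generated_by_iff
        topology_generated_by_topspace)
qed


section \<open>Locally finite counting measures\<close>

definition counting_measures :: "'a::euclidean_space measure set" where
  "counting_measures = {\<phi>. sets \<phi> = sets borel \<and>
     (\<forall>B\<in>sets borel. emeasure \<phi> B \<in> insert \<infinity> \<nat>) \<and>
     (\<forall>B\<in>sets borel. bounded B \<longrightarrow> emeasure \<phi> B < \<infinity>)}"

definition vague_topology :: "'a::euclidean_space measure topology" where
  "vague_topology = initial_topology counting_measures
     {\<lambda>\<phi>. integral\<^sup>L \<phi> g | g. continuous_on UNIV g \<and> compact (closure {x. g x \<noteq> 0})}"

definition counting_borel :: "'a::euclidean_space measure measure" where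
  "counting_borel = sigma counting_measures {U. openin vague_topology U}"

definition counting_measures0 :: "'a::euclidean_space measure set" where
  "counting_measures0 = {\<phi> \<in> counting_measures. emeasure \<phi> {0} > 0}"

definition counting_borel0 :: "'a::euclidean_space measure measure" where
  "counting_borel0 = restrict_space counting_borel counting_measures0"

definition support :: "'a::euclidean_space measure \<Rightarrow> 'a set" where
  "support \<phi> = {x. \<forall>U. open U \<and> x \<in> U \<longrightarrow> emeasure \<phi> U > 0}"

text \<open>The support of \<open>\<phi>\<close> again viewed as a (simple) counting measure on the Borel sets.\<close>

definition support_measure :: "'a::euclidean_space measure \<Rightarrow> 'a measure" where
  "support_measure \<phi> = distr (count_space (support \<phi>)) borel (\<lambda>x. x)"

text \<open>\<open>translate t \<phi> B = \<phi> (B + t)\<close>, i.e. the points of \<open>\<phi>\<close> are moved by \<open>-t\<close>.\<close>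

definition translate :: "'a::euclidean_space \<Rightarrow> 'a measure \<Rightarrow> 'a measure" where
  "translate t \<phi> = distr \<phi> borel (\<lambda>x. x - t)"


section \<open>Point-maps and point-shifts\<close>

definition point_map :: "('a::euclidean_space measure \<Rightarrow> 'a) \<Rightarrow> bool" where
  "point_map f \<longleftrightarrow> f \<in> counting_borel0 \<rightarrow>\<^sub>M borel \<and>
     (\<forall>\<phi>\<in>counting_measures0. f \<phi> = f (support_measure \<phi>) \<and> f \<phi> \<in> support \<phi>)"

definition point_shift :: "('a::euclidean_space measure \<Rightarrow> 'a) \<Rightarrow> 'a measure \<Rightarrow> 'a \<Rightarrow> 'a" where
  "point_shift f \<phi> x = f (translate x \<phi>) + x"

definition preimages ::
  "('a::euclidean_space measure \<Rightarrow> 'a) \<Rightarrow> nat \<Rightarrow> 'a measure \<Rightarrow> 'a \<Rightarrow> 'a set" where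
  "preimages f n \<phi> y = {x. emeasure \<phi> {x} > 0 \<and> (point_shift f \<phi> ^^ n) x = y}"

definition preimage_mass ::
  "('a::euclidean_space measure \<Rightarrow> 'a) \<Rightarrow> nat \<Rightarrow> 'a measure \<Rightarrow> 'a \<Rightarrow> ennreal" where
  "preimage_mass f n \<phi> y = emeasure \<phi> (preimages f n \<phi> y)"

definition map_translate ::
  "('a::euclidean_space measure \<Rightarrow> 'a) \<Rightarrow> 'a measure \<Rightarrow> 'a measure" where
  "map_translate f \<phi> = translate (f \<phi>) \<phi>"


section \<open>Stationary point processes and Palm probabilities\<close>

locale stationary_point_process = prob_space M
  for M :: "'w measure" and \<theta> :: "'a::euclidean_space \<Rightarrow> 'w \<Rightarrow> 'w" and \<Phi> :: "'w \<Rightarrow> 'a measure" +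
  assumes flow_measurable: "(\<lambda>(t, \<omega>). \<theta> t \<omega>) \<in> borel \<Otimes>\<^sub>M M \<rightarrow>\<^sub>M M"
    and flow_zero: "\<And>\<omega>. \<omega> \<in> space M \<Longrightarrow> \<theta> 0 \<omega> = \<omega>"
    and flow_add: "\<And>s t \<omega>. \<omega> \<in> space M \<Longrightarrow> \<theta> (s + t) \<omega> = \<theta> s (\<theta> t \<omega>)"
    and flow_invariant: "\<And>t. distr M M (\<theta> t) = M"
    and process_measurable: "\<Phi> \<in> M \<rightarrow>\<^sub>M counting_borel"
    and process_flow: "\<And>t \<omega>. \<omega> \<in> space M \<Longrightarrow> \<Phi> (\<theta> t \<omega>) = translate t (\<Phi> \<omega>)"

definition simple_process :: "'w measure \<Rightarrow> ('w \<Rightarrow> 'a::euclidean_space measure) \<Rightarrow> bool" where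
  "simple_process M \<Phi> \<longleftrightarrow> (AE \<omega> in M. \<forall>x. emeasure (\<Phi> \<omega>) {x} \<le> 1)"

definition intensity :: "'w measure \<Rightarrow> ('w \<Rightarrow> 'a::euclidean_space measure) \<Rightarrow> ennreal" where
  "intensity M \<Phi> = (\<integral>\<^sup>+\<omega>. emeasure (\<Phi> \<omega>) (cbox 0 One) \<partial>M)"

text \<open>For a stationary point process with intensity in \<open>(0, \<infinity>)\<close> this does not depend on the Borel
  set \<open>B\<close> as long as its Lebesgue measure is positive and finite; \<open>B\<close> is kept as a parameter.\<close>

definition palm_probability ::
  "'w measure \<Rightarrow> ('a::euclidean_space \<Rightarrow> 'w \<Rightarrow> 'w) \<Rightarrow> ('w \<Rightarrow> 'a measure) \<Rightarrow> 'a set \<Rightarrow> 'w measure" where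
  "palm_probability M \<theta> \<Phi> B = measure_of (space M) (sets M)
     (\<lambda>A. (\<integral>\<^sup>+\<omega>. (\<integral>\<^sup>+t\<in>B. indicator A (\<theta> t \<omega>) \<partial>\<Phi> \<omega>) \<partial>M) / (intensity M \<Phi> * emeasure lborel B))"

text \<open>The distribution of \<open>\<Phi>\<close> under its Palm probability charges only configurations with a point
  at the origin, and is regarded as a measure on that subspace.\<close>

definition palm_distribution ::
  "'w measure \<Rightarrow> ('a::euclidean_space \<Rightarrow> 'w \<Rightarrow> 'w) \<Rightarrow> ('w \<Rightarrow> 'a measure) \<Rightarrow> 'a set \<Rightarrow> 'a measure measure"
  where
  "palm_distribution M \<theta> \<Phi> B =
     restrict_space (distr (palm_probability M \<theta> \<Phi> B) counting_borel \<Phi>) counting_measures0"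


section \<open>Weak convergence and point-map probabilities\<close>

definition probabilities0 :: "'a::euclidean_space measure measure set" where
  "probabilities0 = {\<mu>. sets \<mu> = sets counting_borel0 \<and> prob_space \<mu>}"

definition weak_topology :: "'a::euclidean_space measure measure topology" where
  "weak_topology = initial_topology probabilities0
     {\<lambda>\<mu>. integral\<^sup>L \<mu> h | h.
        continuous_map (subtopology vague_topology counting_measures0) euclideanreal h \<and>
        bounded (h ` counting_measures0)}"

definition image_palm ::
  "('a::euclidean_space measure \<Rightarrow> 'a) \<Rightarrow> 'a measure measure \<Rightarrow> nat \<Rightarrow> 'a measure measure" where
  "image_palm f P0 n = distr P0 counting_borel0 (map_translate f ^^ n)"

definition has_point_map_probability ::
  "('a::euclidean_space measure \<Rightarrow> 'a) \<Rightarrow> 'a measure measure \<Rightarrow> 'a measure measure \<Rightarrow> bool" where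
  "has_point_map_probability f P0 Q \<longleftrightarrow> limitin weak_topology (image_palm f P0) Q sequentially"

text \<open>Expectation of a nonnegative variable conditionally on an event of positive probability.\<close>

definition event_expectation :: "'b measure \<Rightarrow> 'b set \<Rightarrow> ('b \<Rightarrow> ennreal) \<Rightarrow> ennreal" where
  "event_expectation M A X = (\<integral>\<^sup>+x. X x \<partial>uniform_measure M A)"

end

theory Submission
  imports Defs
begin

text \<open>The theorem is a conservation law. Let every point of \<open>\<Phi>\<close> send one unit of mass to its image under
\<open>n\<close> steps of the point-shift. Seen from a typical point, the mass sent is \<open>1\<close> and the mass received is
the number \<open>m n\<close> of its \<open>n\<close>-th preimages. Stationarity forces sent and received mass to agree in
the Palm mean, even when only the mass arriving at points whose surroundings lie in a given set \<open>G\<close>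
is counted. For a point at the origin, the configuration seen from the point that it sends its
mass to is \<open>(map_translate f ^^ n) \<phi>\<close>, so this says
\<open>E_0 [m_n 1_G] = P_0 [\<theta>_f^n \<in> G] = P_0^{f,n} [G]\<close>, which is \<open>preimage_mass_eq_image_palm\<close>.

With \<open>G\<close> everything, \<open>E_0 [m_n] = 1\<close>; hence \<open>m_n\<close> is almost surely finite and
\<open>E_0 [m_n | m_n > 0] = 1 / P_0 [m_n > 0]\<close>. Dividing by this number undoes the conditioning
(\<open>size_biased_event_expectation\<close>): the \<open>n\<close>-th term of the sequence in the theorem is exactly
\<open>P_0^{f,n} [G]\<close>, and its convergence is what is assumed about \<open>G\<close>.

The conservation law rests on \<open>mass_transport\<close>, for the pairs formed by a point \<open>t\<close> of \<open>\<Phi>\<close> and a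
point \<open>s\<close> of a second equivariant random measure: counting the mass sent by the points \<open>t \<in> B\<close> or
the mass received by the points \<open>s \<in> B\<close> gives the same mean. The proof writes the volume of \<open>B\<close> as
the integral over \<open>y\<close> of \<open>1_B (t + y)\<close>, moves the whole configuration by \<open>y\<close>, and recognises the
volume of \<open>B\<close> again as the integral of \<open>1_B (s - y)\<close>. Pairing \<open>\<Phi>\<close> with Lebesgue measure yields
\<open>E \<Phi>(B) = \<lambda> |B|\<close> (\<open>mean_measure_eq_intensity\<close>), so that the Palm distribution has mass one;
pairing \<open>\<Phi>\<close> with itself yields the conservation law.

What remains is measurability. All of it is reduced to the maps \<open>\<phi> \<mapsto> \<phi>(A)\<close>: they are measurable for
the Borel sets of the vague topology, and conversely they suffice to test measurability into the
configuration space (\<open>measurable_counting_borelI\<close>), because every vaguely open set is a countable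
union of sets that prescribe the number of points in finitely many small cells.\<close>

section \<open>Integrals against random measures\<close>

definition random_measure :: "'b measure \<Rightarrow> ('b \<Rightarrow> 'a::euclidean_space measure) \<Rightarrow> bool" where
  "random_measure N K \<longleftrightarrow>
     (\<forall>\<omega>\<in>space N. sets (K \<omega>) = sets borel \<and> (\<forall>r. emeasure (K \<omega>) (cball 0 r) < \<infinity>)) \<and>
     (\<forall>A\<in>sets borel. (\<lambda>\<omega>. emeasure (K \<omega>) A) \<in> borel_measurable N)"

lemma emeasure_SUP_cball:
  fixes \<phi> :: "'a::euclidean_space measure"
  assumes "sets \<phi> = sets borel" "A \<in> sets borel"
  shows "emeasure \<phi> A = (SUP r::nat. emeasure \<phi> (A \<inter> cball 0 (real r)))"
proof -
  have "(\<Union>r::nat. A \<inter> cball 0 (real r)) = A"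
    by (auto simp: real_arch_simple)
  moreover have "(SUP r::nat. emeasure \<phi> (A \<inter> cball 0 (real r))) =
      emeasure \<phi> (\<Union>r::nat. A \<inter> cball 0 (real r))"
  proof (rule SUP_emeasure_incseq)
    show "range (\<lambda>r::nat. A \<inter> cball 0 (real r)) \<subseteq> sets \<phi>"
      unfolding assms(1) using assms(2) by (intro image_subsetI sets.Int) simp_all
    show "incseq (\<lambda>r::nat. A \<inter> cball 0 (real r))"
      by (intro incseq_SucI Int_mono subset_cball order_refl) simp
  qed
  ultimately show ?thesis by simp
qed

text \<open>The evaluations of a random measure determine its integrals: rectangles come first, then all
measurable sets, then all nonnegative functions. The complement step subtracts masses, so the
induction on sets is carried out inside balls, where masses are finite.\<close>

lemma measurable_nn_integral_random_measure:
  fixes N :: "'b measure" and K :: "'b \<Rightarrow> 'a::euclidean_space measure"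
  assumes K: "random_measure N K" and h: "h \<in> borel_measurable (N \<Otimes>\<^sub>M borel)"
  shows "(\<lambda>\<omega>. \<integral>\<^sup>+x. h (\<omega>, x) \<partial>K \<omega>) \<in> borel_measurable N"
proof -
  have sets_K: "sets (K \<omega>) = sets borel" if "\<omega> \<in> space N" for \<omega>
    using K that by (auto simp: random_measure_def)
  have space_K: "space (K \<omega>) = UNIV" if "\<omega> \<in> space N" for \<omega>
    using sets_eq_imp_space_eq[OF sets_K[OF that]] by simp
  have fin: "emeasure (K \<omega>) (cball 0 r) < \<infinity>" if "\<omega> \<in> space N" for \<omega> r
    using K that by (auto simp: random_measure_def)
  have ev: "(\<lambda>\<omega>. emeasure (K \<omega>) A) \<in> borel_measurable N" if "A \<in> sets borel" for A
    using K that by (auto simp: random_measure_def)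
  have slice: "Pair \<omega> -` A \<in> sets (K \<omega>)" if "A \<in> sets (N \<Otimes>\<^sub>M borel)" "\<omega> \<in> space N" for A \<omega>
    unfolding sets_K[OF that(2)] using that(1) by (rule sets_Pair1)
  have section_measurable: "(\<lambda>x. u (\<omega>, x)) \<in> borel_measurable (K \<omega>)"
    if "u \<in> borel_measurable (N \<Otimes>\<^sub>M borel)" "\<omega> \<in> space N" for u :: "'b \<times> 'a \<Rightarrow> ennreal" and \<omega>
    using measurable_Pair2[OF that] measurable_cong_sets[OF sets_K[OF that(2)] refl] by blast
  have bounded_slice: "(\<lambda>\<omega>. emeasure (K \<omega>) (Pair \<omega> -` A \<inter> cball 0 r)) \<in> borel_measurable N"
    if A: "A \<in> sets (N \<Otimes>\<^sub>M borel)" for A :: "('b \<times> 'a) set" and r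
  proof -
    have "A \<in> sigma_sets (space N \<times> space borel) {a \<times> b | a b. a \<in> sets N \<and> b \<in> sets borel}"
      using A by (simp add: sets_pair_measure)
    from Int_stable_pair_measure_generator pair_measure_closed this show ?thesis
    proof (induction rule: sigma_sets_induct_disjoint)
      case empty
      then show ?case by simp
    next
      case (basic A)
      then obtain a b where ab: "A = a \<times> b" "a \<in> sets N" "b \<in> sets borel" by auto
      have "(\<lambda>\<omega>. emeasure (K \<omega>) (b \<inter> cball 0 r) * indicator a \<omega>) \<in> borel_measurable N"
        using ab ev[of "b \<inter> cball 0 r"] by measurable
      then show ?case
        by (rule measurable_cong[THEN iffD1, rotated]) (auto simp: ab indicator_def Pair_vimage_Sigma)
    next
      case (compl A)
      then have A: "A \<in> sets (N \<Otimes>\<^sub>M borel)" by (simp add: sets_pair_measure)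
      have "(\<lambda>\<omega>. emeasure (K \<omega>) (cball 0 r) - emeasure (K \<omega>) (Pair \<omega> -` A \<inter> cball 0 r))
          \<in> borel_measurable N"
        using compl ev[of "cball 0 r"] by simp
      moreover have "emeasure (K \<omega>) (Pair \<omega> -` (space N \<times> space borel - A) \<inter> cball 0 r) =
         emeasure (K \<omega>) (cball 0 r) - emeasure (K \<omega>) (Pair \<omega> -` A \<inter> cball 0 r)"
        if \<omega>: "\<omega> \<in> space N" for \<omega>
      proof -
        have "Pair \<omega> -` (space N \<times> space borel - A) \<inter> cball 0 r =
            cball 0 r - (Pair \<omega> -` A \<inter> cball 0 r)"
          using \<omega> by auto
        moreover have "emeasure (K \<omega>) (Pair \<omega> -` A \<inter> cball 0 r) \<le> emeasure (K \<omega>) (cball 0 r)"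
          using sets_K[OF \<omega>] by (intro emeasure_mono) auto
        then have "emeasure (K \<omega>) (Pair \<omega> -` A \<inter> cball 0 r) < \<infinity>"
          using fin[OF \<omega>, of r] by (auto simp: top_unique less_top)
        ultimately show ?thesis
          using slice[OF A \<omega>] sets_K[OF \<omega>] fin[OF \<omega>, of r] by (auto intro!: emeasure_Diff)
      qed
      ultimately show ?case
        by (simp cong: measurable_cong)
    next
      case (union A)
      have A: "A i \<in> sets (N \<Otimes>\<^sub>M borel)" for i using union by (auto simp: sets_pair_measure)
      have "(\<lambda>\<omega>. \<Sum>i. emeasure (K \<omega>) (Pair \<omega> -` A i \<inter> cball 0 r)) \<in> borel_measurable N"
        using union by simp
      moreover have "emeasure (K \<omega>) (Pair \<omega> -` (\<Union>i. A i) \<inter> cball 0 r) =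
        (\<Sum>i. emeasure (K \<omega>) (Pair \<omega> -` A i \<inter> cball 0 r))" if \<omega>: "\<omega> \<in> space N" for \<omega>
      proof -
        have "Pair \<omega> -` (\<Union>i. A i) \<inter> cball 0 r = (\<Union>i. Pair \<omega> -` A i \<inter> cball 0 r)" by auto
        moreover have "disjoint_family (\<lambda>i. Pair \<omega> -` A i \<inter> cball 0 r)"
          using union(1) by (auto simp: disjoint_family_on_def)
        moreover have "range (\<lambda>i. Pair \<omega> -` A i \<inter> cball 0 r) \<subseteq> sets (K \<omega>)"
          using slice[OF A \<omega>] sets_K[OF \<omega>] by auto
        ultimately show ?thesis
          by (simp only: suminf_emeasure)
      qed
      ultimately show ?case
        by (simp cong: measurable_cong)
    qed
  qed
  have slice_measurable: "(\<lambda>\<omega>. emeasure (K \<omega>) (Pair \<omega> -` A)) \<in> borel_measurable N"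
    if A: "A \<in> sets (N \<Otimes>\<^sub>M borel)" for A :: "('b \<times> 'a) set"
  proof -
    have "(\<lambda>\<omega>. SUP r::nat. emeasure (K \<omega>) (Pair \<omega> -` A \<inter> cball 0 (real r))) \<in> borel_measurable N"
      using bounded_slice[OF A] by simp
    then show ?thesis
      by (rule measurable_cong[THEN iffD1, rotated])
        (use slice[OF A] sets_K emeasure_SUP_cball in metis)
  qed
  from h show ?thesis
  proof (induction rule: borel_measurable_induct)
    case (cong f g)
    then have "(\<integral>\<^sup>+x. f (\<omega>, x) \<partial>K \<omega>) = (\<integral>\<^sup>+x. g (\<omega>, x) \<partial>K \<omega>)" if "\<omega> \<in> space N" for \<omega>
      using that by (auto intro!: nn_integral_cong simp: space_pair_measure space_K)
    then show ?case
      using cong by (simp cong: measurable_cong)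
  next
    case (set A)
    have "(\<integral>\<^sup>+x. indicator A (\<omega>, x) \<partial>K \<omega>) = emeasure (K \<omega>) (Pair \<omega> -` A)" if "\<omega> \<in> space N" for \<omega>
    proof -
      have "(\<integral>\<^sup>+x. indicator A (\<omega>, x) \<partial>K \<omega>) = (\<integral>\<^sup>+x. indicator (Pair \<omega> -` A) x \<partial>K \<omega>)"
        by (auto intro!: nn_integral_cong simp: indicator_def)
      then show ?thesis using slice[OF set that] by simp
    qed
    then show ?case
      using slice_measurable[OF set] by (simp cong: measurable_cong)
  next
    case (mult u c)
    have "(\<integral>\<^sup>+x. c * u (\<omega>, x) \<partial>K \<omega>) = c * (\<integral>\<^sup>+x. u (\<omega>, x) \<partial>K \<omega>)" if "\<omega> \<in> space N" for \<omega>
      using section_measurable[OF mult(2) that] by (rule nn_integral_cmult)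
    then show ?case
      using mult by (simp cong: measurable_cong)
  next
    case (add u v)
    have "(\<integral>\<^sup>+x. v (\<omega>, x) + u (\<omega>, x) \<partial>K \<omega>) = (\<integral>\<^sup>+x. v (\<omega>, x) \<partial>K \<omega>) + (\<integral>\<^sup>+x. u (\<omega>, x) \<partial>K \<omega>)"
      if "\<omega> \<in> space N" for \<omega>
      using add that by (intro nn_integral_add section_measurable)
    then show ?case
      using add by (simp cong: measurable_cong)
  next
    case (seq U)
    have "(\<integral>\<^sup>+x. (SUP i. U i) (\<omega>, x) \<partial>K \<omega>) = (SUP i. \<integral>\<^sup>+x. U i (\<omega>, x) \<partial>K \<omega>)"
      if "\<omega> \<in> space N" for \<omega>
      using seq section_measurable[OF _ that]
      by (subst nn_integral_monotone_convergence_SUP[symmetric])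
        (auto simp: incseq_def le_fun_def image_comp)
    then show ?case
      using seq by (simp cong: measurable_cong)
  qed
qed

section \<open>The Borel sets of the vague topology\<close>

lemma space_counting_borel [simp]: "space counting_borel = counting_measures"
  unfolding counting_borel_def by (rule space_measure_of_conv)

lemma vague_open_subset: "openin vague_topology V \<Longrightarrow> V \<subseteq> counting_measures"
  using openin_subset[of vague_topology V] by (simp add: vague_topology_def)

lemma sets_vague_open: "openin vague_topology V \<Longrightarrow> V \<in> sets counting_borel"
  unfolding counting_borel_def using vague_open_subset
  by (subst sets_measure_of) auto

lemma counting_measureD:
  assumes "\<phi> \<in> counting_measures"
  shows "sets \<phi> = sets borel" "space \<phi> = UNIV" "\<And>r. emeasure \<phi> (cball 0 r) < \<infinity>"
    "\<And>A. A \<in> sets borel \<Longrightarrow> bounded A \<Longrightarrow> emeasure \<phi> A < \<infinity>"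
proof -
  show s: "sets \<phi> = sets borel" using assms by (simp add: counting_measures_def)
  show "space \<phi> = UNIV" using sets_eq_imp_space_eq[OF s] by simp
  show "\<And>A. A \<in> sets borel \<Longrightarrow> bounded A \<Longrightarrow> emeasure \<phi> A < \<infinity>"
    using assms by (simp add: counting_measures_def)
  then show "\<And>r. emeasure \<phi> (cball 0 r) < \<infinity>" by simp
qed

lemma counting_measure_nat:
  assumes "\<phi> \<in> counting_measures" "A \<in> sets borel" "bounded A"
  obtains n :: nat where "emeasure \<phi> A = of_nat n"
proof -
  have "emeasure \<phi> A \<in> insert \<infinity> \<nat>" "emeasure \<phi> A < \<infinity>"
    using assms by (auto simp: counting_measures_def)
  then show ?thesis using that by (auto elim: Nats_cases)
qed

lemma borel_measurable_vague_integral: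
  fixes g :: "'a::euclidean_space \<Rightarrow> real"
  assumes "continuous_on UNIV g" "compact (closure {x. g x \<noteq> 0})"
  shows "(\<lambda>\<phi>. integral\<^sup>L \<phi> g) \<in> borel_measurable counting_borel"
proof (rule borel_measurableI)
  fix S :: "real set" assume "open S"
  have "continuous_map vague_topology euclideanreal (\<lambda>\<phi>. integral\<^sup>L \<phi> g)"
    unfolding vague_topology_def
    by (rule continuous_map_initial_topology, rule CollectI, intro exI conjI)
      (rule refl, fact assms(1), fact assms(2))
  then have "openin vague_topology {\<phi> \<in> topspace vague_topology. integral\<^sup>L \<phi> g \<in> S}"
    using \<open>open S\<close> by (auto intro: openin_continuous_map_preimage)
  moreover have "{\<phi> \<in> topspace vague_topology. integral\<^sup>L \<phi> g \<in> S} =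
      (\<lambda>\<phi>. integral\<^sup>L \<phi> g) -` S \<inter> space counting_borel"
    by (auto simp: vague_topology_def)
  ultimately show "(\<lambda>\<phi>. integral\<^sup>L \<phi> g) -` S \<inter> space counting_borel \<in> sets counting_borel"
    using sets_vague_open by metis
qed

text \<open>Vaguely continuous functionals only integrate continuous functions of compact support, but the
indicator of a bounded open set is a limit of such functions, rising to \<open>1\<close> with the distance
to the complement.\<close>

lemma measurable_emeasure_bounded_open:
  fixes U :: "'a::euclidean_space set"
  assumes U: "open U" "bounded U"
  shows "(\<lambda>\<phi>. emeasure \<phi> U) \<in> borel_measurable counting_borel"
proof -
  define g where "g k x = min 1 (real k * infdist x (- U))" for k x
  obtain r where r: "U \<subseteq> cball 0 r"
    using \<open>bounded U\<close> by (auto simp: bounded_iff subset_iff)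
  have nonempty: "- U \<noteq> {}"
  proof
    assume "- U = {}"
    then have "U = UNIV" by auto
    then show False using \<open>bounded U\<close> not_bounded_UNIV by metis
  qed
  have g_outside: "g k x = 0" if "x \<notin> U" for k x
    using that by (simp add: g_def)
  have g_bound: "\<bar>g k x\<bar> \<le> 1" for k x
    by (simp add: g_def infdist_nonneg)
  have cont: "continuous_on UNIV (g k)" for k
    unfolding g_def by (intro continuous_intros)
  have "closure {x. g k x \<noteq> 0} \<subseteq> cball 0 r" for k
    by (rule closure_minimal) (use r g_outside in blast, simp)
  then have "compact (closure {x. g k x \<noteq> 0})" for k
    by (meson bounded_cball bounded_subset closed_closure compact_eq_bounded_closed)
  then have meas: "(\<lambda>\<phi>. integral\<^sup>L \<phi> (g k)) \<in> borel_measurable counting_borel" for k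
    using cont by (intro borel_measurable_vague_integral)
  have lim: "(\<lambda>k. g k x) \<longlonglongrightarrow> indicator U x" for x
  proof (cases "x \<in> U")
    case True
    then have "infdist x (- U) > 0"
      using U nonempty by (simp add: infdist_pos_not_in_closed closed_Compl)
    then obtain k0 :: nat where "1 < real k0 * infdist x (- U)"
      using reals_Archimedean3 by blast
    have "g k x = 1" if "k \<ge> k0" for k
    proof -
      have "real k0 * infdist x (- U) \<le> real k * infdist x (- U)"
        using that by (intro mult_right_mono) (auto simp: infdist_nonneg)
      then show ?thesis
        using \<open>1 < real k0 * infdist x (- U)\<close> by (simp add: g_def)
    qed
    then show ?thesis
      using True by (intro tendsto_eventually) (auto simp: eventually_sequentially)
  qed (simp add: g_outside)
  have conv: "(\<lambda>k. integral\<^sup>L \<phi> (g k)) \<longlonglongrightarrow> measure \<phi> U" if \<phi>: "\<phi> \<in> counting_measures" for \<phi>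
  proof -
    have g_meas: "g k \<in> borel_measurable \<phi>" for k
      using borel_measurable_continuous_onI[OF cont]
        measurable_cong_sets[OF counting_measureD(1)[OF \<phi>] refl] by blast
    have U_sets: "U \<in> sets \<phi>" "emeasure \<phi> U < \<infinity>"
      using U counting_measureD[OF \<phi>] by auto
    have "(\<lambda>k. integral\<^sup>L \<phi> (g k)) \<longlonglongrightarrow> integral\<^sup>L \<phi> (indicator U)"
    proof (rule integral_dominated_convergence[where w = "indicator U"])
      show "AE x in \<phi>. norm (g k x) \<le> indicator U x" for k
        using g_outside g_bound by (auto simp: indicator_def)
    qed (use g_meas U_sets lim in auto)
    then show ?thesis using U_sets by simp
  qed
  have "(\<lambda>\<phi>. measure \<phi> U) \<in> borel_measurable counting_borel"
    by (rule borel_measurable_LIMSEQ_real[where u = "\<lambda>k \<phi>. integral\<^sup>L \<phi> (g k)"])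
      (simp_all add: conv meas)
  then have "(\<lambda>\<phi>. ennreal (measure \<phi> U)) \<in> borel_measurable counting_borel"
    by measurable
  then show ?thesis
  proof (rule measurable_cong[THEN iffD1, rotated])
    fix \<phi> :: "'a measure" assume "\<phi> \<in> space counting_borel"
    then show "ennreal (measure \<phi> U) = emeasure \<phi> U"
      using counting_measureD(4)[of \<phi> U] U by (intro emeasure_eq_ennreal_measure[symmetric]) auto
  qed
qed

lemma measurable_emeasure_counting_borel:
  fixes A :: "'a::euclidean_space set"
  assumes A: "A \<in> sets borel"
  shows "(\<lambda>\<phi>. emeasure \<phi> A) \<in> borel_measurable counting_borel"
proof -
  have bounded_part: "(\<lambda>\<phi>. emeasure \<phi> (A \<inter> ball 0 r)) \<in> borel_measurable counting_borel"
    if "A \<in> sets borel" for A :: "'a set" and r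
  proof -
    have "Int_stable {S :: 'a set. open S}" by (auto simp: Int_stable_def)
    moreover have "{S :: 'a set. open S} \<subseteq> Pow UNIV" by simp
    moreover have "A \<in> sigma_sets UNIV {S. open S}"
      using that by (simp add: borel_def)
    ultimately show ?thesis
    proof (induction rule: sigma_sets_induct_disjoint)
      case (basic A)
      then show ?case by (intro measurable_emeasure_bounded_open) auto
    next
      case empty
      then show ?case by simp
    next
      case (compl A)
      then have "A \<in> sets borel" by (simp add: borel_def)
      have eq: "emeasure \<phi> ((UNIV - A) \<inter> ball 0 r) = emeasure \<phi> (ball 0 r) - emeasure \<phi> (A \<inter> ball 0 r)"
        if "\<phi> \<in> space counting_borel" for \<phi>
      proof -
        have \<phi>: "\<phi> \<in> counting_measures" using that by simp
        have "(UNIV - A) \<inter> ball 0 r = ball 0 r - (A \<inter> ball 0 r)" by auto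
        moreover have "emeasure \<phi> (A \<inter> ball 0 r) < \<infinity>"
          using \<open>A \<in> sets borel\<close> by (intro counting_measureD(4)[OF \<phi>]) auto
        ultimately show ?thesis
          using \<open>A \<in> sets borel\<close> counting_measureD(1)[OF \<phi>] by (auto intro!: emeasure_Diff)
      qed
      have "(\<lambda>\<phi>. emeasure \<phi> (ball 0 r) - emeasure \<phi> (A \<inter> ball 0 r))
          \<in> borel_measurable counting_borel"
        by (intro borel_measurable_minus_ennreal measurable_emeasure_bounded_open compl.IH) simp_all
      then show ?case by (rule measurable_cong[THEN iffD2, rotated]) (rule eq)
    next
      case (union A)
      then have A: "A i \<in> sets borel" for i by (auto simp: borel_def)
      have eq: "emeasure \<phi> ((\<Union>i. A i) \<inter> ball 0 r) = (\<Sum>i. emeasure \<phi> (A i \<inter> ball 0 r))"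
        if "\<phi> \<in> space counting_borel" for \<phi>
      proof -
        have \<phi>: "\<phi> \<in> counting_measures" using that by simp
        have "(\<Union>i. A i) \<inter> ball 0 r = (\<Union>i. A i \<inter> ball 0 r)" by auto
        moreover have "disjoint_family (\<lambda>i. A i \<inter> ball 0 r)"
          using union(1) by (auto simp: disjoint_family_on_def)
        moreover have "range (\<lambda>i. A i \<inter> ball 0 r) \<subseteq> sets \<phi>"
          using A counting_measureD(1)[OF \<phi>] by auto
        ultimately show ?thesis by (simp only: suminf_emeasure)
      qed
      have "(\<lambda>\<phi>. \<Sum>i. emeasure \<phi> (A i \<inter> ball 0 r)) \<in> borel_measurable counting_borel"
        by (intro borel_measurable_suminf_order union.IH)
      then show ?case by (rule measurable_cong[THEN iffD2, rotated]) (rule eq)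
    qed
  qed
  have "(\<lambda>\<phi>. SUP r::nat. emeasure \<phi> (A \<inter> cball 0 (real r))) \<in> borel_measurable counting_borel"
  proof (rule borel_measurable_SUP)
    fix r :: nat
    have "A \<inter> cball 0 (real r) = A \<inter> cball 0 (real r) \<inter> ball 0 (real r + 1)" by auto
    then show "(\<lambda>\<phi>. emeasure \<phi> (A \<inter> cball 0 (real r))) \<in> borel_measurable counting_borel"
      using bounded_part[of "A \<inter> cball 0 (real r)" "real r + 1"] A by simp
  qed simp
  then show ?thesis
    by (rule measurable_cong[THEN iffD1, rotated])
      (simp add: emeasure_SUP_cball[OF counting_measureD(1) A])
qed

lemma random_measure_counting:
  assumes "X \<in> N \<rightarrow>\<^sub>M counting_borel"
  shows "random_measure N X"
  unfolding random_measure_def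
proof (intro conjI ballI allI)
  fix \<omega> r assume "\<omega> \<in> space N"
  then have "X \<omega> \<in> counting_measures" using measurable_space[OF assms] by simp
  then show "sets (X \<omega>) = sets borel" "emeasure (X \<omega>) (cball 0 r) < \<infinity>"
    using counting_measureD by auto
next
  fix A :: "'b set" assume "A \<in> sets borel"
  from measurable_compose[OF assms measurable_emeasure_counting_borel[OF this]]
  show "(\<lambda>\<omega>. emeasure (X \<omega>) A) \<in> borel_measurable N" .
qed

text \<open>The vague topology has a countable base in the following sense. Label each point of space by the first
element of a fixed dense sequence that lies within \<open>1 / (k + 1)\<close> of it. The points with a given
label form a cell of small diameter, and a ball meets only finitely many cells. Prescribing the number
of points of a configuration in each of these cells fixes its integral against a given continuous
function up to a small error, and there are only countably many such prescriptions.\<close>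

definition dense_seq :: "nat \<Rightarrow> 'a::euclidean_space" where
  "dense_seq = (SOME d. \<forall>x. \<forall>e>0. \<exists>j. dist x (d j) < e)"

lemma dense_seq:
  fixes x :: "'a::euclidean_space"
  assumes "e > 0"
  obtains j where "dist x (dense_seq j) < e"
proof -
  obtain D :: "'a set" where D: "countable D" "\<And>X. open X \<Longrightarrow> X \<noteq> {} \<Longrightarrow> \<exists>d\<in>D. d \<in> X"
    using countable_dense_setE by blast
  have "\<exists>j. dist x (from_nat_into D j) < e" if e: "e > 0" for x :: 'a and e
  proof -
    obtain d where "d \<in> D" "d \<in> ball x e"
      using D(2)[of "ball x e"] e by auto
    then show ?thesis using from_nat_into_surj[OF D(1)] by (metis mem_ball)
  qed
  then have "\<exists>d :: nat \<Rightarrow> 'a. \<forall>x. \<forall>e>0. \<exists>j. dist x (d j) < e" by blast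
  then have "\<forall>x :: 'a. \<forall>e>0. \<exists>j. dist x (dense_seq j) < e"
    unfolding dense_seq_def by (rule someI_ex)
  then show ?thesis using assms that by blast
qed

definition cell :: "nat \<Rightarrow> nat \<Rightarrow> 'a::euclidean_space set" where
  "cell k j = {x. (LEAST i. dist x (dense_seq i) < 1 / real (Suc k)) = j}"

lemma sets_cell [measurable]: "(cell k j :: 'a::euclidean_space set) \<in> sets borel"
proof -
  have "(\<lambda>x :: 'a. LEAST i. dist x (dense_seq i) < 1 / real (Suc k)) \<in> borel \<rightarrow>\<^sub>M count_space UNIV"
    by measurable
  from measurable_sets[OF this, of "{j}"] show ?thesis
    by (simp add: cell_def vimage_def)
qed

lemma dist_cell:
  assumes "x \<in> cell k j"
  shows "dist x (dense_seq j) < 1 / real (Suc k)"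
proof -
  obtain i where "dist x (dense_seq i) < 1 / real (Suc k)"
    using dense_seq[of "1 / real (Suc k)" x] by auto
  then show ?thesis
    using assms LeastI[of "\<lambda>i. dist x (dense_seq i) < 1 / real (Suc k)"] by (simp add: cell_def)
qed

text \<open>A triple \<open>(k, r, ns)\<close> prescribes the number of points in the parts of the cells of level \<open>k\<close> inside the
ball of radius \<open>r\<close>, for the first \<open>length ns\<close> labels. Lists of triples make the family closed under
intersection while its index type stays countable.\<close>

definition count_cylinder :: "(nat \<times> nat \<times> nat list) list \<Rightarrow> 'a::euclidean_space measure set" where
  "count_cylinder l = {\<phi> \<in> counting_measures. \<forall>(k, r, ns) \<in> set l. \<forall>j<length ns.
     emeasure \<phi> (cell k j \<inter> cball 0 (real r)) = of_nat (ns ! j)}"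

lemma count_cylinder_append: "count_cylinder (l @ l') = count_cylinder l \<inter> count_cylinder l'"
  unfolding count_cylinder_def set_append ball_Un by blast

text \<open>If \<open>g\<close> varies by at most \<open>\<delta>\<close> on each cell, then two configurations with the same counts, and hence with
the same number \<open>C\<close> of points in the ball that carries \<open>g\<close>, have integrals that differ by at most
\<open>2 * \<delta> * C\<close>: both are within \<open>\<delta> * C\<close> of the integral of one step function.\<close>

lemma count_cylinder_approximates:
  fixes g :: "'a::euclidean_space \<Rightarrow> real"
  assumes \<phi>\<^sub>0: "\<phi>\<^sub>0 \<in> counting_measures" and "e > 0"
    and g: "continuous_on UNIV g" "compact (closure {x. g x \<noteq> 0})"
  shows "\<exists>l. \<phi>\<^sub>0 \<in> count_cylinder l \<and>
    (\<forall>\<phi>\<in>count_cylinder l. dist (integral\<^sup>L \<phi> g) (integral\<^sup>L \<phi>\<^sub>0 g) < e)"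
proof -
  have "bounded {x. g x \<noteq> 0}"
    using g(2) bounded_subset closure_subset compact_imp_bounded by metis
  then obtain r' where r': "\<And>x. g x \<noteq> 0 \<Longrightarrow> norm x \<le> r'"
    by (auto simp: bounded_iff)
  obtain r :: nat where "r' \<le> real r" using real_arch_simple by blast
  with r' have g_support: "x \<in> cball 0 (real r)" if "g x \<noteq> 0" for x
    using that by (fastforce simp: mem_cball_0)
  define C where "C = measure \<phi>\<^sub>0 (cball 0 (real r))"
  \<comment> \<open>The summand 1 keeps the denominator positive when the ball carries no points.\<close>
  define \<delta> where "\<delta> = e / (2 * C + 1)"
  have "C \<ge> 0" by (simp add: C_def)
  then have "\<delta> > 0" using \<open>e > 0\<close> by (simp add: \<delta>_def)
  have "2 * (\<delta> * C) < e"
    using \<open>C \<ge> 0\<close> \<open>e > 0\<close> by (simp add: \<delta>_def field_simps)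
  have "uniformly_continuous_on (cball 0 (real r)) g"
    using g(1) by (intro compact_uniformly_continuous) (auto intro: continuous_on_subset)
  then obtain \<eta> where "\<eta> > 0"
    and \<eta>: "\<And>x y. x \<in> cball 0 (real r) \<Longrightarrow> y \<in> cball 0 (real r) \<Longrightarrow> dist y x < \<eta> \<Longrightarrow> dist (g y) (g x) < \<delta>"
    using \<open>\<delta> > 0\<close> unfolding uniformly_continuous_on_def by meson
  obtain k where k: "1 / real (Suc k) < \<eta> / 2"
    using nat_approx_posE[of "\<eta> / 2"] \<open>\<eta> > 0\<close> by auto
  have "cball 0 (real r) \<subseteq> (\<Union>j. ball (dense_seq j :: 'a) (1 / real (Suc k)))"
  proof
    fix x :: 'a
    obtain j where "dist x (dense_seq j) < 1 / real (Suc k)"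
      using dense_seq[of "1 / real (Suc k)" x] by auto
    then show "x \<in> (\<Union>j. ball (dense_seq j) (1 / real (Suc k)))"
      by (auto simp: dist_commute)
  qed
  then obtain J :: "nat set" where "finite J"
    and J: "cball 0 (real r) \<subseteq> (\<Union>j\<in>J. ball (dense_seq j :: 'a) (1 / real (Suc k)))"
    using compactE_image[of "cball 0 (real r)" UNIV "\<lambda>j. ball (dense_seq j) (1 / real (Suc k))"]
    by (metis compact_cball open_ball)
  obtain m where m: "\<And>j. j \<in> J \<Longrightarrow> j < m"
    using \<open>finite J\<close> finite_nat_set_iff_bounded by auto
  define Q :: "nat \<Rightarrow> 'a set" where "Q j = cell k j \<inter> cball 0 (real r)" for j
  have Q_sets: "Q j \<in> sets borel" "bounded (Q j)" for j
    unfolding Q_def by (simp_all add: bounded_Int)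
  have Q_cover: "\<exists>j<m. x \<in> Q j" if x: "x \<in> cball 0 (real r)" for x
  proof -
    have "x \<in> (\<Union>j\<in>J. ball (dense_seq j) (1 / real (Suc k)))"
      using J x by blast
    then obtain j where "j \<in> J" and j: "dist x (dense_seq j) < 1 / real (Suc k)"
      by (metis UN_E mem_ball dist_commute)
    from j have "(LEAST i. dist x (dense_seq i) < 1 / real (Suc k)) \<le> j"
      by (rule Least_le)
    also have "j < m" using m \<open>j \<in> J\<close> .
    finally show ?thesis using x unfolding Q_def cell_def by blast
  qed
  have Q_unique: "x \<in> Q i \<longleftrightarrow> i = j" if "x \<in> Q j" for x i j
    using that by (auto simp: Q_def cell_def)
  have sum_indicator: "(\<Sum>i<m. a i * indicator (Q i) x) = a j" if "x \<in> Q j" "j < m" for a :: "nat \<Rightarrow> real" and x j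
  proof -
    have "(\<Sum>i<m. a i * indicator (Q i) x) = (\<Sum>i<m. if i = j then a j else 0)"
      by (rule sum.cong) (auto simp: indicator_def Q_unique[OF that(1)])
    then show ?thesis using that(2) by simp
  qed
  have sum_outside: "(\<Sum>i<m. a i * indicator (Q i) x) = 0" if "x \<notin> cball 0 (real r)" for a :: "nat \<Rightarrow> real" and x
    using that by (intro sum.neutral) (auto simp: Q_def)
  have "\<exists>n::nat. emeasure \<phi>\<^sub>0 (Q j) = of_nat n" for j
    using counting_measure_nat[OF \<phi>\<^sub>0 Q_sets] by blast
  then obtain c :: "nat \<Rightarrow> nat" where c: "\<And>j. emeasure \<phi>\<^sub>0 (Q j) = of_nat (c j)" by metis
  define l where "l = [(k, r, map c [0..<m])]"
  define v where "v j = g (SOME x. x \<in> Q j)" for j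
  define s where "s x = (\<Sum>j<m. v j * indicator (Q j) x)" for x
  have v: "\<bar>g x - v j\<bar> \<le> \<delta>" if x: "x \<in> Q j" for x j
  proof -
    define y where "y = (SOME x. x \<in> Q j)"
    have y: "y \<in> Q j" unfolding y_def using x by (rule someI)
    have "dist x (dense_seq j) < 1 / real (Suc k)" "dist y (dense_seq j) < 1 / real (Suc k)"
      using x y unfolding Q_def by (blast intro: dist_cell)+
    then have "dist x y < \<eta>"
      using k dist_triangle2[of x y "dense_seq j"] by linarith
    then have "dist (g x) (g y) < \<delta>"
      using x y by (intro \<eta>) (auto simp: Q_def)
    then show ?thesis by (simp add: v_def y_def dist_real_def)
  qed
  have g_s: "\<bar>g x - s x\<bar> \<le> \<delta> * indicator (cball 0 (real r)) x" for x
  proof (cases "x \<in> cball 0 (real r)")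
    case True
    then obtain j where "j < m" "x \<in> Q j" using Q_cover by blast
    then have "s x = v j"
      unfolding s_def by (intro sum_indicator)
    then show ?thesis
      using v[OF \<open>x \<in> Q j\<close>] True by simp
  next
    case False
    then have "g x = 0" "s x = 0"
      using g_support[of x] unfolding s_def by (blast, intro sum_outside)
    then show ?thesis using False by simp
  qed
  have bound: "\<bar>integral\<^sup>L \<phi> g - (\<Sum>j<m. v j * real (c j))\<bar> \<le> \<delta> * (\<Sum>j<m. real (c j))"
      "measure \<phi> (cball 0 (real r)) = (\<Sum>j<m. real (c j))"
    if \<phi>: "\<phi> \<in> count_cylinder l" for \<phi>
  proof -
    have \<phi>N: "\<phi> \<in> counting_measures" using \<phi> by (simp add: count_cylinder_def)
    have sets_\<phi>: "sets \<phi> = sets borel" using counting_measureD(1)[OF \<phi>N] .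
    have fin: "emeasure \<phi> (Q j) < \<infinity>" for j using counting_measureD(4)[OF \<phi>N Q_sets] .
    have "emeasure \<phi> (Q j) = of_nat (c j)" if "j < m" for j
      using \<phi> that by (auto simp: count_cylinder_def l_def Q_def)
    then have meas: "measure \<phi> (Q j) = real (c j)" if "j < m" for j
      using that by (simp add: measure_def)
    have Q_int: "integrable \<phi> (indicator (Q j) :: 'a \<Rightarrow> real)" for j
      using fin Q_sets sets_\<phi> by (simp add: integrable_indicator_iff)
    have ball_int: "integrable \<phi> (indicator (cball 0 (real r)) :: 'a \<Rightarrow> real)"
      using counting_measureD(3)[OF \<phi>N, of "real r"] sets_\<phi> by (simp add: integrable_indicator_iff)
    have step_int: "integrable \<phi> (\<lambda>x. \<Sum>j<m. a j * indicator (Q j) x)"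
      "(\<integral>x. (\<Sum>j<m. a j * indicator (Q j) x) \<partial>\<phi>) = (\<Sum>j<m. a j * real (c j))" for a
    proof -
      show "integrable \<phi> (\<lambda>x. \<Sum>j<m. a j * indicator (Q j) x)"
        by (intro Bochner_Integration.integrable_sum integrable_mult_right Q_int)
      have "(\<integral>x. (\<Sum>j<m. a j * indicator (Q j) x) \<partial>\<phi>) = (\<Sum>j<m. \<integral>x. a j * indicator (Q j) x \<partial>\<phi>)"
        by (intro Bochner_Integration.integral_sum integrable_mult_right Q_int)
      also have "\<dots> = (\<Sum>j<m. a j * real (c j))"
        using counting_measureD(2)[OF \<phi>N] by (intro sum.cong) (simp_all add: meas)
      finally show "(\<integral>x. (\<Sum>j<m. a j * indicator (Q j) x) \<partial>\<phi>) = (\<Sum>j<m. a j * real (c j))" .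
    qed
    have "indicator (cball 0 (real r)) x = (\<Sum>j<m. 1 * indicator (Q j) x :: real)" for x
    proof (cases "x \<in> cball 0 (real r)")
      case True
      then obtain j where "j < m" "x \<in> Q j" using Q_cover by blast
      then show ?thesis using True sum_indicator[of x j "\<lambda>_. 1"] by simp
    next
      case False
      then show ?thesis using sum_outside[of x "\<lambda>_. 1"] by simp
    qed
    then have "(\<integral>x. indicator (cball 0 (real r)) x \<partial>\<phi>) = (\<Sum>j<m. 1 * real (c j))"
      using step_int(2)[of "\<lambda>_. 1"] by simp
    then show mass: "measure \<phi> (cball 0 (real r)) = (\<Sum>j<m. real (c j))"
      using sets_\<phi> sets_eq_imp_space_eq[OF sets_\<phi>] by simp
    have g_meas: "g \<in> borel_measurable \<phi>"
      using borel_measurable_continuous_onI[OF g(1)] measurable_cong_sets[OF sets_\<phi> refl] by blast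
    have s_int: "integrable \<phi> s" "integral\<^sup>L \<phi> s = (\<Sum>j<m. v j * real (c j))"
      using step_int[of v] by (simp_all add: s_def[abs_def])
    have "integrable \<phi> (\<lambda>x. g x - s x)"
    proof (rule Bochner_Integration.integrable_bound)
      show "integrable \<phi> (\<lambda>x. \<delta> * indicator (cball 0 (real r)) x)"
        using ball_int by simp
      show "(\<lambda>x. g x - s x) \<in> borel_measurable \<phi>"
        using g_meas borel_measurable_integrable[OF s_int(1)] by simp
      show "AE x in \<phi>. norm (g x - s x) \<le> norm (\<delta> * indicator (cball 0 (real r)) x)"
        using g_s \<open>\<delta> > 0\<close> by (intro AE_I2) (simp add: abs_mult)
    qed
    from Bochner_Integration.integrable_add[OF this s_int(1)] have g_int: "integrable \<phi> g"
      by simp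
    have "\<bar>integral\<^sup>L \<phi> g - integral\<^sup>L \<phi> s\<bar> = \<bar>\<integral>x. g x - s x \<partial>\<phi>\<bar>"
      using g_int s_int by simp
    also have "\<dots> \<le> (\<integral>x. \<bar>g x - s x\<bar> \<partial>\<phi>)"
      by (rule integral_abs_bound)
    also have "\<dots> \<le> (\<integral>x. \<delta> * indicator (cball 0 (real r)) x \<partial>\<phi>)"
      using g_int s_int ball_int g_s by (intro integral_mono) auto
    also have "\<dots> = \<delta> * (\<Sum>j<m. real (c j))"
      using mass sets_\<phi> sets_eq_imp_space_eq[OF sets_\<phi>] by simp
    finally show "\<bar>integral\<^sup>L \<phi> g - (\<Sum>j<m. v j * real (c j))\<bar> \<le> \<delta> * (\<Sum>j<m. real (c j))"
      using s_int by simp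
  qed
  have \<phi>\<^sub>0_l: "\<phi>\<^sub>0 \<in> count_cylinder l"
    using \<phi>\<^sub>0 c by (auto simp: count_cylinder_def l_def Q_def)
  moreover have "dist (integral\<^sup>L \<phi> g) (integral\<^sup>L \<phi>\<^sub>0 g) < e" if "\<phi> \<in> count_cylinder l" for \<phi>
  proof -
    have C: "(\<Sum>j<m. real (c j)) = C" using bound(2)[OF \<phi>\<^sub>0_l] by (simp add: C_def)
    then show ?thesis
      using bound(1)[OF that] bound(1)[OF \<phi>\<^sub>0_l] \<open>2 * (\<delta> * C) < e\<close>
      unfolding dist_real_def C by linarith
  qed
  ultimately show ?thesis by blast
qed

text \<open>The cylinders refine the subbasic open sets, and, being closed under intersection, also all sets
generated from them.\<close>

lemma vague_open_contains_count_cylinder: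
  fixes V :: "'a::euclidean_space measure set"
  assumes V: "openin vague_topology V" and \<phi>: "\<phi> \<in> V"
  shows "\<exists>l. \<phi> \<in> count_cylinder l \<and> count_cylinder l \<subseteq> V"
proof -
  have "generate_topology_on
      (insert counting_measures {{\<phi> \<in> counting_measures. h \<phi> \<in> U} | (h :: _ \<Rightarrow> real) U.
        h \<in> {\<lambda>\<phi>. integral\<^sup>L \<phi> g | g. continuous_on UNIV g \<and> compact (closure {x. g x \<noteq> 0})} \<and> open U}) V"
    using V by (simp only: vague_topology_def initial_topology_def openin_topology_generated_by_iff)
  from this \<phi> show ?thesis
  proof induction
    case Empty
    then show ?case by simp
  next
    case (Int a b)
    then obtain l l' where "\<phi> \<in> count_cylinder l" "count_cylinder l \<subseteq> a"
      "\<phi> \<in> count_cylinder l'" "count_cylinder l' \<subseteq> b" by blast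
    then show ?case by (intro exI[of _ "l @ l'"]) (auto simp: count_cylinder_append)
  next
    case (UN K)
    then show ?case by (meson UnionE Union_upper order_trans)
  next
    case (Basis s)
    then have "s = counting_measures \<or> (\<exists>(h :: _ \<Rightarrow> real) U. s = {\<phi> \<in> counting_measures. h \<phi> \<in> U} \<and>
        (\<exists>g. h = (\<lambda>\<phi>. integral\<^sup>L \<phi> g) \<and> continuous_on UNIV g \<and> compact (closure {x. g x \<noteq> 0})) \<and> open U)"
      by (simp only: insert_iff mem_Collect_eq)
    then show ?case
    proof (elim disjE exE conjE)
      assume "s = counting_measures"
      then show ?thesis
        using Basis.prems by (intro exI[of _ "[]"]) (simp add: count_cylinder_def)
    next
      fix h U and g :: "'a \<Rightarrow> real"
      assume "s = {\<phi> \<in> counting_measures. h \<phi> \<in> U}" and h: "h = (\<lambda>\<phi>. integral\<^sup>L \<phi> g)"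
        and g: "open U" "continuous_on UNIV g" "compact (closure {x. g x \<noteq> 0})"
      then have s: "s = {\<phi> \<in> counting_measures. integral\<^sup>L \<phi> g \<in> U}" by simp
      then have \<phi>: "\<phi> \<in> counting_measures" "integral\<^sup>L \<phi> g \<in> U"
        using Basis.prems by simp_all
      obtain e where "e > 0" and e: "ball (integral\<^sup>L \<phi> g) e \<subseteq> U"
        using \<phi> g(1) openE by blast
      obtain l where "\<phi> \<in> count_cylinder l"
        and l: "\<And>\<psi>. \<psi> \<in> count_cylinder l \<Longrightarrow> dist (integral\<^sup>L \<psi> g) (integral\<^sup>L \<phi> g) < e"
        using count_cylinder_approximates[OF \<phi>(1) \<open>e > 0\<close> g(2,3)] by blast
      moreover have "count_cylinder l \<subseteq> s"
      proof
        fix \<psi> :: "'a measure" assume \<psi>: "\<psi> \<in> count_cylinder l"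
        then have "integral\<^sup>L \<psi> g \<in> U"
          using l[OF \<psi>] e by (auto simp: dist_commute)
        then show "\<psi> \<in> s"
          using \<psi> by (simp add: s count_cylinder_def)
      qed
      ultimately show ?thesis by blast
    qed
  qed
qed

text \<open>An arbitrary union of cylinders is a countable one, so the preimage of an open set is a countable union
of sets described by finitely many evaluations.\<close>

theorem measurable_counting_borelI:
  fixes X :: "'b \<Rightarrow> 'a::euclidean_space measure"
  assumes X: "\<And>\<omega>. \<omega> \<in> space N \<Longrightarrow> X \<omega> \<in> counting_measures"
    and ev: "\<And>A. A \<in> sets borel \<Longrightarrow> (\<lambda>\<omega>. emeasure (X \<omega>) A) \<in> borel_measurable N"
  shows "X \<in> N \<rightarrow>\<^sub>M counting_borel"
  unfolding counting_borel_def
proof (rule measurable_measure_of)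
  show "{U. openin vague_topology U} \<subseteq> Pow counting_measures"
    using vague_open_subset by auto
  show "X \<in> space N \<rightarrow> counting_measures"
    using X by auto
  have cyl: "X -` count_cylinder l \<inter> space N \<in> sets N" for l
  proof -
    have "{\<omega>\<in>space N. emeasure (X \<omega>) (cell k j \<inter> cball 0 (real r)) = of_nat n} \<in> sets N" for k j r n
      using ev[of "cell k j \<inter> cball 0 (real r)"] by measurable
    then have "{\<omega>\<in>space N. \<forall>z\<in>set l. \<forall>j\<in>{..<length (snd (snd z))}.
        emeasure (X \<omega>) (cell (fst z) j \<inter> cball 0 (real (fst (snd z)))) = of_nat (snd (snd z) ! j)} \<in> sets N"
      by (intro sets.sets_Collect_finite_All) auto
    moreover have "X -` count_cylinder l \<inter> space N = {\<omega>\<in>space N. \<forall>z\<in>set l. \<forall>j\<in>{..<length (snd (snd z))}.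
        emeasure (X \<omega>) (cell (fst z) j \<inter> cball 0 (real (fst (snd z)))) = of_nat (snd (snd z) ! j)}"
      using X unfolding count_cylinder_def split_beta by blast
    ultimately show ?thesis by simp
  qed
  fix V assume "V \<in> {U. openin vague_topology (U :: 'a measure set)}"
  then have V: "openin vague_topology V" by simp
  define L where "L = {l. count_cylinder l \<subseteq> V}"
  have V_eq: "V = (\<Union>l\<in>L. count_cylinder l)"
    using vague_open_contains_count_cylinder[OF V] unfolding L_def by blast
  have "X -` V \<inter> space N = (\<Union>l\<in>L. X -` count_cylinder l \<inter> space N)"
    by (subst V_eq) blast
  also have "\<dots> \<in> sets N"
    using cyl by (intro sets.countable_UN') auto
  finally show "X -` V \<inter> space N \<in> sets N" .
qed

section \<open>Translations and atoms\<close>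

lemma sets_translate [simp, measurable_cong]: "sets (translate t \<phi>) = sets borel"
  and space_translate [simp]: "space (translate t \<phi>) = UNIV"
  by (simp_all add: translate_def)

lemma nn_integral_translate:
  fixes \<phi> :: "'a::euclidean_space measure"
  assumes "sets \<phi> = sets borel" "h \<in> borel_measurable borel"
  shows "(\<integral>\<^sup>+x. h x \<partial>translate t \<phi>) = (\<integral>\<^sup>+x. h (x - t) \<partial>\<phi>)"
proof -
  have "(\<lambda>x. x - t) \<in> \<phi> \<rightarrow>\<^sub>M borel"
    unfolding measurable_cong_sets[OF assms(1) refl] by measurable
  then show ?thesis
    unfolding translate_def by (rule nn_integral_distr) (simp add: assms(2))
qed

lemma emeasure_translate:
  fixes \<phi> :: "'a::euclidean_space measure"
  assumes "sets \<phi> = sets borel" "A \<in> sets borel"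
  shows "emeasure (translate t \<phi>) A = emeasure \<phi> ((\<lambda>x. x - t) -` A)"
proof -
  have "(\<lambda>x. x - t) \<in> \<phi> \<rightarrow>\<^sub>M borel"
    unfolding measurable_cong_sets[OF assms(1) refl] by measurable
  then show ?thesis
    using assms(2) sets_eq_imp_space_eq[OF assms(1)] by (simp add: translate_def emeasure_distr)
qed

lemma emeasure_translate_singleton:
  fixes \<phi> :: "'a::euclidean_space measure"
  assumes "sets \<phi> = sets borel"
  shows "emeasure (translate t \<phi>) {x} = emeasure \<phi> {x + t}"
proof -
  have "(\<lambda>z. z - t) -` {x} = {x + t}" by (auto simp: algebra_simps)
  then show ?thesis using emeasure_translate[OF assms, of "{x}" t] by simp
qed

lemma translate_translate:
  fixes \<phi> :: "'a::euclidean_space measure"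
  assumes "sets \<phi> = sets borel"
  shows "translate s (translate t \<phi>) = translate (s + t) \<phi>"
proof (rule measure_eqI)
  fix A assume "A \<in> sets (translate s (translate t \<phi>))"
  then have A: "A \<in> sets borel" by simp
  have "(\<lambda>x. x - s) -` A \<in> sets borel"
    using measurable_sets[of "\<lambda>x. x - s" borel borel A] A by simp
  then show "emeasure (translate s (translate t \<phi>)) A = emeasure (translate (s + t) \<phi>) A"
    using A assms by (simp add: emeasure_translate vimage_def algebra_simps)
qed simp

lemma translate_0:
  fixes \<phi> :: "'a::euclidean_space measure"
  assumes "sets \<phi> = sets borel"
  shows "translate 0 \<phi> = \<phi>"
  by (rule measure_eqI) (simp_all add: assms emeasure_translate)

lemma translate_counting_measures [intro]:
  fixes \<phi> :: "'a::euclidean_space measure"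
  assumes "\<phi> \<in> counting_measures"
  shows "translate t \<phi> \<in> counting_measures"
proof -
  have s: "sets \<phi> = sets borel" using counting_measureD(1)[OF assms] .
  have "(\<lambda>x. x - t) -` A \<in> sets borel" if "A \<in> sets borel" for A :: "'a set"
    using measurable_sets[of "\<lambda>x. x - t" borel borel A] that by simp
  moreover have "bounded ((\<lambda>x. x - t) -` A)" if "bounded A" for A :: "'a set"
  proof -
    have "(\<lambda>x. x - t) -` A = (\<lambda>x. t + x) ` A"
      by (auto simp: image_iff intro!: bexI[of _ "_ - t"])
    then show ?thesis using bounded_translation[OF that, of t] by simp
  qed
  ultimately show ?thesis
    using assms s by (auto simp: counting_measures_def emeasure_translate)
qed

lemma measurable_translate [measurable (raw)]:
  fixes X :: "'b \<Rightarrow> 'a::euclidean_space measure"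
  assumes T: "T \<in> borel_measurable N" and X: "X \<in> N \<rightarrow>\<^sub>M counting_borel"
  shows "(\<lambda>\<omega>. translate (T \<omega>) (X \<omega>)) \<in> N \<rightarrow>\<^sub>M counting_borel"
proof (rule measurable_counting_borelI)
  have X_in: "X \<omega> \<in> counting_measures" if "\<omega> \<in> space N" for \<omega>
    using measurable_space[OF X that] by simp
  then show "translate (T \<omega>) (X \<omega>) \<in> counting_measures" if "\<omega> \<in> space N" for \<omega>
    using that by blast
  fix A :: "'a set" assume A [measurable]: "A \<in> sets borel"
  have "(\<lambda>z. indicator A (snd z - T (fst z)) :: ennreal) \<in> borel_measurable (N \<Otimes>\<^sub>M borel)"
    using T by measurable
  from measurable_nn_integral_random_measure[OF random_measure_counting[OF X] this]
  have "(\<lambda>\<omega>. \<integral>\<^sup>+x. indicator A (x - T \<omega>) \<partial>X \<omega>) \<in> borel_measurable N" by simp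
  moreover have "emeasure (translate (T \<omega>) (X \<omega>)) A = (\<integral>\<^sup>+x. indicator A (x - T \<omega>) \<partial>X \<omega>)"
    if "\<omega> \<in> space N" for \<omega>
    using nn_integral_translate[OF counting_measureD(1)[OF X_in[OF that]], of "indicator A" "T \<omega>"]
    by simp
  ultimately show "(\<lambda>\<omega>. emeasure (translate (T \<omega>) (X \<omega>)) A) \<in> borel_measurable N"
    by (simp cong: measurable_cong)
qed

lemma counting_measure_atom_ge_1:
  assumes "\<phi> \<in> counting_measures" "emeasure \<phi> A > 0" "A \<in> sets borel"
  shows "emeasure \<phi> A \<ge> 1"
proof -
  have "emeasure \<phi> A \<in> insert \<infinity> \<nat>"
    using assms by (auto simp: counting_measures_def)
  then show ?thesis
  proof
    assume "emeasure \<phi> A \<in> \<nat>"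
    then obtain n :: nat where n: "emeasure \<phi> A = of_nat n" by (auto elim: Nats_cases)
    with assms(2) have "n \<ge> 1" by (cases n) auto
    then have "(of_nat 1 :: ennreal) \<le> of_nat n" by (rule of_nat_mono)
    then show ?thesis by (simp add: n)
  qed simp
qed

text \<open>Balls shrinking to a point of the support have positive integer mass, hence mass at least one; by
continuity from above so has the point.\<close>

lemma support_atom:
  fixes \<phi> :: "'a::euclidean_space measure"
  assumes \<phi>: "\<phi> \<in> counting_measures" and x: "x \<in> support \<phi>"
  shows "emeasure \<phi> {x} > 0"
proof -
  have "(\<lambda>n. emeasure \<phi> (ball x (1 / real (Suc n)))) \<longlonglongrightarrow>
      emeasure \<phi> (\<Inter>n. ball x (1 / real (Suc n)))"
  proof (rule Lim_emeasure_decseq)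
    show "range (\<lambda>n. ball x (1 / real (Suc n))) \<subseteq> sets \<phi>"
      unfolding counting_measureD(1)[OF \<phi>] by (intro image_subsetI) simp
    show "decseq (\<lambda>n. ball x (1 / real (Suc n)))"
      by (intro decseq_SucI subset_ball divide_left_mono) simp_all
    show "emeasure \<phi> (ball x (1 / real (Suc n))) \<noteq> \<infinity>" for n
      using counting_measureD(4)[OF \<phi>, of "ball x (1 / real (Suc n))"] by (simp del: of_nat_Suc)
  qed
  moreover have "1 \<le> emeasure \<phi> (ball x (1 / real (Suc n)))" for n
    using x by (intro counting_measure_atom_ge_1[OF \<phi>]) (auto simp: support_def)
  moreover have "(\<Inter>n. ball x (1 / real (Suc n))) = {x}"
  proof -
    have "y = x" if y: "\<And>n. dist x y < 1 / real (Suc n)" for y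
    proof (rule ccontr)
      assume "y \<noteq> x"
      then obtain n where "1 / real (Suc n) < dist x y"
        using nat_approx_posE[of "dist x y"] by auto
      with y[of n] show False by simp
    qed
    then show ?thesis by (auto simp del: of_nat_Suc)
  qed
  ultimately have "1 \<le> emeasure \<phi> {x}"
    by (intro LIMSEQ_le_const) auto
  then show ?thesis using less_le_trans zero_less_one by blast
qed

text \<open>By the Lindelof property the complement of the support is a countable union of open null sets.\<close>

lemma AE_atom:
  fixes \<phi> :: "'a::euclidean_space measure"
  assumes \<phi>: "\<phi> \<in> counting_measures"
  shows "AE x in \<phi>. emeasure \<phi> {x} > 0"
proof -
  let ?F = "{U. open U \<and> emeasure \<phi> U = 0}"
  obtain F' where F': "F' \<subseteq> ?F" "countable F'" "\<Union>F' = \<Union>?F"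
    using Lindelof[of ?F] by auto
  have "(\<Union>U\<in>F'. U) \<in> null_sets \<phi>"
    using F' counting_measureD(1)[OF \<phi>] by (intro null_sets_UN') (auto simp: null_sets_def)
  moreover have "x \<in> \<Union>F'" if "\<not> emeasure \<phi> {x} > 0" for x
  proof -
    have "x \<notin> support \<phi>" using that support_atom[OF \<phi>] by blast
    then obtain U where "open U" "x \<in> U" "emeasure \<phi> U = 0"
      by (auto simp: support_def zero_less_iff_neq_zero)
    then show ?thesis unfolding F'(3) by blast
  qed
  ultimately show ?thesis
    by (intro AE_I'[of "\<Union>F'"]) auto
qed

lemma sets_counting_measures0: "counting_measures0 \<in> sets counting_borel"
proof -
  have "(\<lambda>\<phi>. emeasure \<phi> {0}) \<in> borel_measurable counting_borel"
    by (rule measurable_emeasure_counting_borel) simp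
  then have "{\<phi> \<in> space counting_borel. 0 < emeasure \<phi> {0}} \<in> sets counting_borel"
    by measurable
  then show ?thesis by (simp add: counting_measures0_def)
qed

lemma counting_measures0_subset: "counting_measures0 \<subseteq> counting_measures"
  by (auto simp: counting_measures0_def)

lemma space_counting_borel0 [simp]: "space counting_borel0 = counting_measures0"
  using counting_measures0_subset by (auto simp: counting_borel0_def space_restrict_space)

lemma sets_counting_borel0:
  "G \<in> sets counting_borel0 \<longleftrightarrow> G \<in> sets counting_borel \<and> G \<subseteq> counting_measures0"
  unfolding counting_borel0_def
  by (subst sets_restrict_space_iff)
    (auto simp: Int_absorb2[OF counting_measures0_subset] sets_counting_measures0)

lemma measurable_counting_borel0I:
  assumes "X \<in> N \<rightarrow>\<^sub>M counting_borel" "\<And>\<omega>. \<omega> \<in> space N \<Longrightarrow> X \<omega> \<in> counting_measures0"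
  shows "X \<in> N \<rightarrow>\<^sub>M counting_borel0"
  unfolding counting_borel0_def by (rule measurable_restrict_space2) (use assms in auto)

lemma measurable_counting_borel0_borel: "(\<lambda>\<phi>. \<phi>) \<in> counting_borel0 \<rightarrow>\<^sub>M counting_borel"
  unfolding counting_borel0_def by (rule measurable_restrict_space1) simp

lemma translate_counting_measures0:
  fixes \<phi> :: "'a::euclidean_space measure"
  assumes "\<phi> \<in> counting_measures"
  shows "translate x \<phi> \<in> counting_measures0 \<longleftrightarrow> emeasure \<phi> {x} > 0"
  using assms translate_counting_measures[OF assms, of x] counting_measureD(1)[OF assms]
  by (simp add: counting_measures0_def emeasure_translate_singleton)

section \<open>Iterates of a point-map\<close>

text \<open>Position of the origin after \<open>n\<close> steps of the point-shift. Since point-shifts commute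
with translations, it determines both the orbits of all other points and the iterates of
\<open>map_translate f\<close>.\<close>

definition orbit :: "('a::euclidean_space measure \<Rightarrow> 'a) \<Rightarrow> nat \<Rightarrow> 'a measure \<Rightarrow> 'a" where
  "orbit f n \<phi> = (point_shift f \<phi> ^^ n) 0"

lemma point_shift_iterate_eq_orbit:
  fixes \<phi> :: "'a::euclidean_space measure"
  assumes "sets \<phi> = sets borel"
  shows "(point_shift f \<phi> ^^ n) x = x + orbit f n (translate x \<phi>)"
proof (induction n)
  case 0
  then show ?case by (simp add: orbit_def)
next
  case (Suc n)
  then show ?case
    by (simp add: orbit_def point_shift_def translate_translate[OF assms] algebra_simps)
qed

lemma map_translate_iterate_eq_orbit:
  fixes \<phi> :: "'a::euclidean_space measure"
  assumes "sets \<phi> = sets borel"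
  shows "(map_translate f ^^ n) \<phi> = translate (orbit f n \<phi>) \<phi>"
proof (induction n)
  case 0
  then show ?case by (simp add: orbit_def translate_0[OF assms])
next
  case (Suc n)
  then show ?case
    by (simp add: orbit_def map_translate_def point_shift_def translate_translate[OF assms])
qed

text \<open>The mass that the origin sends to \<open>x\<close>: one unit if \<open>x\<close> is reached in \<open>n\<close> steps, provided that the
configuration seen from \<open>x\<close> lies in \<open>G\<close>.\<close>

definition transport ::
  "('a::euclidean_space measure \<Rightarrow> 'a) \<Rightarrow> nat \<Rightarrow> 'a measure set \<Rightarrow> 'a measure \<times> 'a \<Rightarrow> ennreal" where
  "transport f n G = (\<lambda>(\<phi>, x). of_bool (\<phi> \<in> counting_measures0 \<and> orbit f n \<phi> = x \<and> translate x \<phi> \<in> G))"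

context
  fixes f :: "'a::euclidean_space measure \<Rightarrow> 'a"
  assumes f: "point_map f"
begin

lemma map_translate_closed:
  assumes "\<phi> \<in> counting_measures0"
  shows "map_translate f \<phi> \<in> counting_measures0"
proof -
  have \<phi>: "\<phi> \<in> counting_measures" using assms counting_measures0_subset by auto
  have "f \<phi> \<in> support \<phi>" using f assms by (auto simp: point_map_def)
  then show ?thesis
    using support_atom[OF \<phi>] translate_counting_measures0[OF \<phi>] by (simp add: map_translate_def)
qed

lemma measurable_map_translate_iterate:
  "(map_translate f ^^ n) \<in> counting_borel0 \<rightarrow>\<^sub>M counting_borel0"
proof (induction n)
  case 0
  then show ?case by simp
next
  case (Suc n)
  have "map_translate f \<in> counting_borel0 \<rightarrow>\<^sub>M counting_borel0"
  proof (rule measurable_counting_borel0I)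
    have "(\<lambda>\<phi>. translate (f \<phi>) \<phi>) \<in> counting_borel0 \<rightarrow>\<^sub>M counting_borel"
      using f by (intro measurable_translate measurable_counting_borel0_borel) (simp add: point_map_def)
    then show "map_translate f \<in> counting_borel0 \<rightarrow>\<^sub>M counting_borel"
      by (simp add: map_translate_def[abs_def])
  qed (simp add: map_translate_closed)
  from measurable_comp[OF Suc this] show ?case by (simp add: comp_def)
qed

lemma measurable_orbit: "orbit f n \<in> borel_measurable counting_borel0"
proof (induction n)
  case 0
  then show ?case by (simp add: orbit_def[abs_def])
next
  case (Suc n)
  have "(\<lambda>\<phi>. f ((map_translate f ^^ n) \<phi>) + orbit f n \<phi>) \<in> borel_measurable counting_borel0"
    using f Suc measurable_compose[OF measurable_map_translate_iterate]
    by (intro borel_measurable_add) (auto simp: point_map_def)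
  moreover have "orbit f (Suc n) \<phi> = f ((map_translate f ^^ n) \<phi>) + orbit f n \<phi>"
    if "\<phi> \<in> counting_measures0" for \<phi>
  proof -
    have "sets \<phi> = sets borel" using that counting_measures0_subset counting_measureD(1) by blast
    then show ?thesis
      by (simp add: map_translate_iterate_eq_orbit) (simp add: orbit_def point_shift_def)
  qed
  ultimately show ?case
    by (subst measurable_cong) auto
qed

text \<open>The iterates of \<open>map_translate f\<close> stay among the configurations with a point at the origin.\<close>

lemma orbit_atom:
  assumes "\<phi> \<in> counting_measures0"
  shows "emeasure \<phi> {orbit f n \<phi>} > 0"
proof -
  have \<phi>: "\<phi> \<in> counting_measures" using assms counting_measures0_subset by auto
  have "(map_translate f ^^ n) \<phi> \<in> counting_measures0"
    using measurable_space[OF measurable_map_translate_iterate] assms by simp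
  then show ?thesis
    using map_translate_iterate_eq_orbit[OF counting_measureD(1)[OF \<phi>]]
      translate_counting_measures0[OF \<phi>] by simp
qed

lemma measurable_transport:
  assumes "G \<in> sets counting_borel"
  shows "transport f n G \<in> borel_measurable (counting_borel \<Otimes>\<^sub>M borel)"
proof -
  \<comment> \<open>The value 0 outside the configurations with a point at the origin is arbitrary: \<open>transport\<close> vanishes there.\<close>
  have o: "(\<lambda>\<phi>. if \<phi> \<in> counting_measures0 then orbit f n \<phi> else 0) \<in> counting_borel \<rightarrow>\<^sub>M borel"
    using measurable_orbit[of n] sets_counting_measures0[where 'a = 'a] unfolding counting_borel0_def
    by (subst measurable_If_restrict_space_iff)
      (auto simp: Int_def[symmetric] Int_commute[of counting_measures] Int_absorb2[OF counting_measures0_subset])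
  note [measurable] = assms sets_counting_measures0 o
  have "(\<lambda>z. of_bool (fst z \<in> counting_measures0 \<and> (if fst z \<in> counting_measures0 then orbit f n (fst z) else 0) = snd z
       \<and> translate (snd z) (fst z) \<in> G) :: ennreal) \<in> borel_measurable (counting_borel \<Otimes>\<^sub>M borel)"
    by measurable
  then show ?thesis
    by (rule measurable_cong[THEN iffD1, rotated]) (auto simp: transport_def split_beta)
qed

end

section \<open>Mass transport for stationary laws\<close>

lemma random_measure_sigma_finite:
  fixes \<mu> :: "'a::euclidean_space measure"
  assumes "sets \<mu> = sets borel" "\<And>r. emeasure \<mu> (cball 0 r) < \<infinity>"
  shows "sigma_finite_measure \<mu>"
proof
  have "(\<Union>n::nat. cball 0 (real n)) = (UNIV :: 'a set)"
    by (auto simp: real_arch_simple)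
  moreover have "emeasure \<mu> (cball 0 (real n)) \<noteq> \<infinity>" for n :: nat
    using assms(2)[of "real n"] by simp
  ultimately show "\<exists>A. countable A \<and> A \<subseteq> sets \<mu> \<and> \<Union>A = space \<mu> \<and> (\<forall>a\<in>A. emeasure \<mu> a \<noteq> \<infinity>)"
    using assms(1) sets_eq_imp_space_eq[OF assms(1)]
    by (intro exI[of _ "range (\<lambda>n::nat. cball 0 (real n))"]) auto
qed

lemma nn_integral_swap:
  assumes "sigma_finite_measure \<mu>" "sigma_finite_measure \<nu>"
    and "sets \<mu> = sets M" "sets \<nu> = sets N" "(\<lambda>z. h (fst z) (snd z)) \<in> borel_measurable (M \<Otimes>\<^sub>M N)"
  shows "(\<integral>\<^sup>+x. \<integral>\<^sup>+y. h x y \<partial>\<nu> \<partial>\<mu>) = (\<integral>\<^sup>+y. \<integral>\<^sup>+x. h x y \<partial>\<mu> \<partial>\<nu>)"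
proof -
  interpret pair_sigma_finite \<mu> \<nu>
    using assms by (simp add: pair_sigma_finite_def)
  have "case_prod h \<in> borel_measurable (\<mu> \<Otimes>\<^sub>M \<nu>)"
    using assms(5) measurable_cong_sets[OF sets_pair_measure_cong[OF assms(3,4)] refl]
    unfolding split_beta' by blast
  from Fubini'[OF this] show ?thesis by simp
qed

lemma measurable_kernel_integral:
  assumes K: "random_measure N K" and X: "X \<in> N' \<rightarrow>\<^sub>M N"
    and h: "(\<lambda>z. h (fst z) (snd z)) \<in> borel_measurable (N' \<Otimes>\<^sub>M borel)"
  shows "(\<lambda>z. \<integral>\<^sup>+s. h z s \<partial>K (X z)) \<in> borel_measurable N'"
proof -
  have "random_measure N' (\<lambda>z. K (X z))"
    unfolding random_measure_def
  proof (intro conjI ballI allI)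
    fix z r assume "z \<in> space N'"
    then have "X z \<in> space N" by (rule measurable_space[OF X])
    then show "sets (K (X z)) = sets borel" "emeasure (K (X z)) (cball 0 r) < \<infinity>"
      using K by (simp_all add: random_measure_def)
  next
    fix A :: "'b set" assume "A \<in> sets borel"
    then have "(\<lambda>\<omega>. emeasure (K \<omega>) A) \<in> borel_measurable N"
      using K by (simp add: random_measure_def)
    then show "(\<lambda>z. emeasure (K (X z)) A) \<in> borel_measurable N'"
      by (rule measurable_compose[OF X])
  qed
  from measurable_nn_integral_random_measure[OF this h] show ?thesis by simp
qed

lemma lborel_indicator_shift:
  fixes B :: "'a::euclidean_space set"
  assumes [measurable]: "B \<in> sets borel"
  shows "(\<integral>\<^sup>+y. indicator B (t + y) \<partial>lborel) = emeasure lborel B"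
    and "(\<integral>\<^sup>+y. indicator B (t - y) \<partial>lborel) = emeasure lborel B"
proof -
  have "(\<integral>\<^sup>+y. indicator B (t + c *\<^sub>R y) \<partial>lborel) = emeasure lborel B" if c: "\<bar>c\<bar> = 1" for c :: real
  proof -
    have "c \<noteq> 0" using c by auto
    have "(\<integral>\<^sup>+y. indicator B y \<partial>lborel) =
        (\<integral>\<^sup>+y. indicator B y \<partial>density (distr lborel borel (\<lambda>x. t + c *\<^sub>R x)) (\<lambda>_. \<bar>c\<bar> ^ DIM('a)))"
      using lborel_affine[OF \<open>c \<noteq> 0\<close>, of t] by simp
    also have "\<dots> = (\<integral>\<^sup>+y. indicator B y \<partial>distr lborel borel (\<lambda>x. t + c *\<^sub>R x))"
      using c by (simp add: density_1 one_ennreal_def[symmetric])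
    also have "\<dots> = (\<integral>\<^sup>+y. indicator B (t + c *\<^sub>R y) \<partial>lborel)"
      by (rule nn_integral_distr) measurable
    finally show ?thesis by simp
  qed
  from this[of 1] this[of "- 1"]
  show "(\<integral>\<^sup>+y. indicator B (t + y) \<partial>lborel) = emeasure lborel B"
    "(\<integral>\<^sup>+y. indicator B (t - y) \<partial>lborel) = emeasure lborel B" by simp_all
qed

locale stationary_law = prob_space P for P :: "'a::euclidean_space measure measure" +
  assumes sets_law: "sets P = sets counting_borel"
    and law_invariant: "\<And>y. distr P counting_borel (translate y) = P"
begin

lemma space_law: "space P = counting_measures"
  using sets_eq_imp_space_eq[OF sets_law] by simp

lemma measurable_law: "borel_measurable P = borel_measurable counting_borel"
  by (rule measurable_cong_sets) (simp_all add: sets_law)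

lemma nn_integral_translate_law:
  assumes "G \<in> borel_measurable counting_borel"
  shows "(\<integral>\<^sup>+\<phi>. G (translate y \<phi>) \<partial>P) = (\<integral>\<^sup>+\<phi>. G \<phi> \<partial>P)"
proof -
  have "translate y \<in> counting_borel \<rightarrow>\<^sub>M counting_borel"
    by (rule measurable_translate) simp_all
  then have "translate y \<in> P \<rightarrow>\<^sub>M counting_borel"
    by (subst measurable_cong_sets[OF sets_law refl])
  then have "(\<integral>\<^sup>+\<phi>. G \<phi> \<partial>distr P counting_borel (translate y)) = (\<integral>\<^sup>+\<phi>. G (translate y \<phi>) \<partial>P)"
    by (rule nn_integral_distr) (simp add: assms)
  then show ?thesis
    by (simp add: law_invariant)
qed

text \<open>Here \<open>w (translate t \<phi>, s - t)\<close> is the mass sent from the point \<open>t\<close> of \<open>\<phi>\<close> to the point \<open>s\<close> of \<open>K \<phi>\<close>;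
it depends only on the configuration seen from \<open>t\<close> and on the displacement, so it is unchanged when
everything is translated. Both sides are compared after multiplication by the volume \<open>b\<close> of \<open>B\<close>.
Starting from the right hand side, \<open>b\<close> is spread out over the translates of \<open>B\<close> that contain \<open>t\<close>
(\<open>J\<close>), the configuration is shifted back (\<open>H\<close>), and then the translates of \<open>B\<close> that contain \<open>s\<close>
are integrated out.\<close>

theorem mass_transport:
  assumes K: "random_measure counting_borel K"
    and K_translate: "\<And>y \<phi>. \<phi> \<in> counting_measures \<Longrightarrow> K (translate y \<phi>) = translate y (K \<phi>)"
    and w: "w \<in> borel_measurable (counting_borel \<Otimes>\<^sub>M borel)"
    and B [measurable]: "B \<in> sets borel" and B_pos: "0 < emeasure lborel B" "emeasure lborel B < \<infinity>"
  shows "(\<integral>\<^sup>+\<phi>. \<integral>\<^sup>+t. (\<integral>\<^sup>+s. w (translate t \<phi>, s - t) \<partial>K \<phi>) * indicator B t \<partial>\<phi> \<partial>P) =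
    (\<integral>\<^sup>+\<phi>. \<integral>\<^sup>+t. \<integral>\<^sup>+s. w (translate t \<phi>, s - t) * indicator B s \<partial>K \<phi> \<partial>\<phi> \<partial>P)" (is "?L = ?R")
proof -
  define b where "b = emeasure lborel B"
  define A where "A \<phi> t = (\<integral>\<^sup>+s. w (translate t \<phi>, s - t) * indicator B s \<partial>K \<phi>)" for \<phi> t
  define J where "J \<phi> y = (\<integral>\<^sup>+t. A \<phi> t * indicator B (t + y) \<partial>\<phi>)" for \<phi> y
  define D where "D \<phi> t y = (\<integral>\<^sup>+s. w (translate t \<phi>, s - t) * indicator B (s - y) \<partial>K \<phi>)" for \<phi> t y
  define H where "H \<phi> y = (\<integral>\<^sup>+t. D \<phi> t y * indicator B t \<partial>\<phi>)" for \<phi> y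
  have id: "random_measure counting_borel (\<lambda>\<phi> :: 'a measure. \<phi>)"
    by (rule random_measure_counting) simp
  have sets_K: "sets (K \<phi>) = sets borel" and K_fin: "\<And>r. emeasure (K \<phi>) (cball 0 r) < \<infinity>"
    if "\<phi> \<in> counting_measures" for \<phi>
    using K that by (auto simp: random_measure_def)
  have w_comp: "(\<lambda>z. w (translate (T z) (X z), S z - T z)) \<in> borel_measurable N"
    if "X \<in> N \<rightarrow>\<^sub>M counting_borel" "T \<in> borel_measurable N" "S \<in> borel_measurable N"
    for X :: "'c \<Rightarrow> 'a measure" and T S N
    by (rule measurable_compose[OF _ w])
      (intro measurable_Pair measurable_translate borel_measurable_diff that)
  have points: "(\<lambda>z. \<integral>\<^sup>+s. h z s \<partial>X z) \<in> borel_measurable N"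
    if "X \<in> N \<rightarrow>\<^sub>M counting_borel" "(\<lambda>z. h (fst z) (snd z)) \<in> borel_measurable (N \<Otimes>\<^sub>M borel)"
    for X :: "'c \<Rightarrow> 'a measure" and h N
    using measurable_kernel_integral[OF id that] .
  have A_comp: "(\<lambda>z. A (X z) (T z)) \<in> borel_measurable N"
    if [measurable]: "X \<in> N \<rightarrow>\<^sub>M counting_borel" "T \<in> borel_measurable N"
    for X :: "'c \<Rightarrow> 'a measure" and T N
    unfolding A_def
    by (intro measurable_kernel_integral[OF K] borel_measurable_times_ennreal w_comp; measurable)
  have D_comp: "(\<lambda>z. D (X z) (T z) (Y z)) \<in> borel_measurable N"
    if [measurable]: "X \<in> N \<rightarrow>\<^sub>M counting_borel" "T \<in> borel_measurable N" "Y \<in> borel_measurable N"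
    for X :: "'c \<Rightarrow> 'a measure" and T Y N
    unfolding D_def
    by (intro measurable_kernel_integral[OF K] borel_measurable_times_ennreal w_comp; measurable)
  have J_comp: "(\<lambda>z. J (X z) (Y z)) \<in> borel_measurable N"
    if [measurable]: "X \<in> N \<rightarrow>\<^sub>M counting_borel" "Y \<in> borel_measurable N"
    for X :: "'c \<Rightarrow> 'a measure" and Y N
    unfolding J_def by (intro points borel_measurable_times_ennreal A_comp; measurable)
  have H_comp: "(\<lambda>z. H (X z) (Y z)) \<in> borel_measurable N"
    if [measurable]: "X \<in> N \<rightarrow>\<^sub>M counting_borel" "Y \<in> borel_measurable N"
    for X :: "'c \<Rightarrow> 'a measure" and Y N
    unfolding H_def by (intro points borel_measurable_times_ennreal D_comp; measurable)
  have const: "(\<lambda>_. \<phi>) \<in> N \<rightarrow>\<^sub>M counting_borel" if "\<phi> \<in> counting_measures" for \<phi> and N :: "'c measure"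
    using that by simp
  have to_kernel: "h \<in> borel_measurable (K \<phi>)" if "h \<in> borel_measurable borel" "\<phi> \<in> counting_measures"
    for h :: "'a \<Rightarrow> ennreal" and \<phi>
    using that(1) measurable_cong_sets[OF sets_K[OF that(2)] refl] by blast
  have to_points: "h \<in> borel_measurable \<phi>" if "h \<in> borel_measurable borel" "\<phi> \<in> counting_measures"
    for h :: "'a \<Rightarrow> ennreal" and \<phi>
    using that(1) measurable_cong_sets[OF counting_measureD(1)[OF that(2)] refl] by blast
  have sf: "sigma_finite_measure \<phi>" "sigma_finite_measure (K \<phi>)" if "\<phi> \<in> counting_measures" for \<phi>
    by (intro random_measure_sigma_finite counting_measureD(1,3) sets_K K_fin that)+
  have lborel_sf: "sigma_finite_measure (lborel :: 'a measure)" by unfold_locales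
  have spread_out: "(\<integral>\<^sup>+t. A \<phi> t \<partial>\<phi>) * b = (\<integral>\<^sup>+y. J \<phi> y \<partial>lborel)" if \<phi>: "\<phi> \<in> counting_measures" for \<phi>
  proof -
    have "(\<integral>\<^sup>+t. A \<phi> t \<partial>\<phi>) * b = (\<integral>\<^sup>+t. A \<phi> t * b \<partial>\<phi>)"
      by (rule nn_integral_multc[symmetric], rule to_points[OF _ \<phi>], rule A_comp[OF const[OF \<phi>]]) simp
    also have "\<dots> = (\<integral>\<^sup>+t. \<integral>\<^sup>+y. A \<phi> t * indicator B (t + y) \<partial>lborel \<partial>\<phi>)"
    proof (rule nn_integral_cong)
      fix t
      have "(\<integral>\<^sup>+y. A \<phi> t * indicator B (t + y) \<partial>lborel) = A \<phi> t * (\<integral>\<^sup>+y. indicator B (t + y) \<partial>lborel)"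
        by (rule nn_integral_cmult) measurable
      then show "A \<phi> t * b = (\<integral>\<^sup>+y. A \<phi> t * indicator B (t + y) \<partial>lborel)"
        by (simp only: lborel_indicator_shift[OF B] b_def)
    qed
    also have "\<dots> = (\<integral>\<^sup>+y. \<integral>\<^sup>+t. A \<phi> t * indicator B (t + y) \<partial>\<phi> \<partial>lborel)"
      by (rule nn_integral_swap[OF sf(1)[OF \<phi>] lborel_sf counting_measureD(1)[OF \<phi>] sets_lborel])
        (intro borel_measurable_times_ennreal A_comp const \<phi>; measurable)
    finally show ?thesis by (simp add: J_def)
  qed
  have shift: "J (translate y \<phi>) y = H \<phi> y" if \<phi>: "\<phi> \<in> counting_measures" for \<phi> y
  proof -
    note \<phi>' = translate_counting_measures[OF \<phi>]
    have A_D: "A (translate y \<phi>) (t - y) = D \<phi> t y" for t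
    proof -
      have "A (translate y \<phi>) (t - y) =
          (\<integral>\<^sup>+s. w (translate (t - y) (translate y \<phi>), s - (t - y)) * indicator B s \<partial>translate y (K \<phi>))"
        unfolding A_def K_translate[OF \<phi>] ..
      also have "\<dots> = (\<integral>\<^sup>+s. w (translate (t - y) (translate y \<phi>), s - y - (t - y)) * indicator B (s - y) \<partial>K \<phi>)"
        by (rule nn_integral_translate[OF sets_K[OF \<phi>]])
          (intro borel_measurable_times_ennreal w_comp const \<phi>'; measurable)
      also have "\<dots> = D \<phi> t y"
        by (simp add: D_def translate_translate[OF counting_measureD(1)[OF \<phi>]])
      finally show ?thesis .
    qed
    have "J (translate y \<phi>) y = (\<integral>\<^sup>+t. A (translate y \<phi>) (t - y) * indicator B (t - y + y) \<partial>\<phi>)"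
      unfolding J_def
      by (rule nn_integral_translate[OF counting_measureD(1)[OF \<phi>]])
        (intro borel_measurable_times_ennreal A_comp const \<phi>'; measurable)
    then show ?thesis by (simp add: A_D H_def)
  qed
  have collect: "(\<integral>\<^sup>+y. H \<phi> y \<partial>lborel) =
      (\<integral>\<^sup>+t. (\<integral>\<^sup>+s. w (translate t \<phi>, s - t) \<partial>K \<phi>) * indicator B t \<partial>\<phi>) * b" if \<phi>: "\<phi> \<in> counting_measures" for \<phi>
  proof -
    have inner: "(\<integral>\<^sup>+y. D \<phi> t y \<partial>lborel) = (\<integral>\<^sup>+s. w (translate t \<phi>, s - t) \<partial>K \<phi>) * b" for t
    proof -
      have "(\<integral>\<^sup>+y. D \<phi> t y \<partial>lborel) =
          (\<integral>\<^sup>+s. \<integral>\<^sup>+y. w (translate t \<phi>, s - t) * indicator B (s - y) \<partial>lborel \<partial>K \<phi>)"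
        unfolding D_def
        by (rule nn_integral_swap[OF lborel_sf sf(2)[OF \<phi>] sets_lborel sets_K[OF \<phi>]])
          (intro borel_measurable_times_ennreal w_comp const \<phi>; measurable)
      also have "\<dots> = (\<integral>\<^sup>+s. w (translate t \<phi>, s - t) * b \<partial>K \<phi>)"
      proof (rule nn_integral_cong)
        fix s
        have "(\<integral>\<^sup>+y. w (translate t \<phi>, s - t) * indicator B (s - y) \<partial>lborel) =
            w (translate t \<phi>, s - t) * (\<integral>\<^sup>+y. indicator B (s - y) \<partial>lborel)"
          by (rule nn_integral_cmult) measurable
        then show "(\<integral>\<^sup>+y. w (translate t \<phi>, s - t) * indicator B (s - y) \<partial>lborel) =
            w (translate t \<phi>, s - t) * b"
          by (simp only: lborel_indicator_shift[OF B] b_def)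
      qed
      also have "\<dots> = (\<integral>\<^sup>+s. w (translate t \<phi>, s - t) \<partial>K \<phi>) * b"
        by (intro nn_integral_multc to_kernel w_comp const \<phi>) simp_all
      finally show ?thesis .
    qed
    have "(\<integral>\<^sup>+y. H \<phi> y \<partial>lborel) = (\<integral>\<^sup>+t. \<integral>\<^sup>+y. D \<phi> t y * indicator B t \<partial>lborel \<partial>\<phi>)"
      unfolding H_def
      by (rule nn_integral_swap[OF lborel_sf sf(1)[OF \<phi>] sets_lborel counting_measureD(1)[OF \<phi>]])
        (intro borel_measurable_times_ennreal D_comp const \<phi>; measurable)
    also have "\<dots> = (\<integral>\<^sup>+t. ((\<integral>\<^sup>+s. w (translate t \<phi>, s - t) \<partial>K \<phi>) * indicator B t) * b \<partial>\<phi>)"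
    proof (rule nn_integral_cong)
      fix t
      have "(\<integral>\<^sup>+y. D \<phi> t y * indicator B t \<partial>lborel) = (\<integral>\<^sup>+y. D \<phi> t y \<partial>lborel) * indicator B t"
        by (rule nn_integral_multc) (simp add: D_comp[OF const[OF \<phi>]])
      then show "(\<integral>\<^sup>+y. D \<phi> t y * indicator B t \<partial>lborel) =
          ((\<integral>\<^sup>+s. w (translate t \<phi>, s - t) \<partial>K \<phi>) * indicator B t) * b"
        by (simp only: inner ac_simps)
    qed
    also have "\<dots> = (\<integral>\<^sup>+t. (\<integral>\<^sup>+s. w (translate t \<phi>, s - t) \<partial>K \<phi>) * indicator B t \<partial>\<phi>) * b"
    proof (rule nn_integral_multc, rule to_points[OF _ \<phi>])
      show "(\<lambda>t. (\<integral>\<^sup>+s. w (translate t \<phi>, s - t) \<partial>K \<phi>) * indicator B t) \<in> borel_measurable borel"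
        by (intro borel_measurable_times_ennreal measurable_kernel_integral[OF K const[OF \<phi>]] w_comp const \<phi>;
            measurable)
    qed
    finally show ?thesis .
  qed
  have "?R * b = (\<integral>\<^sup>+\<phi>. (\<integral>\<^sup>+t. A \<phi> t \<partial>\<phi>) * b \<partial>P)"
    unfolding A_def[symmetric]
    by (rule nn_integral_multc[symmetric]) (unfold measurable_law, intro points A_comp; measurable)
  also have "\<dots> = (\<integral>\<^sup>+\<phi>. \<integral>\<^sup>+y. J \<phi> y \<partial>lborel \<partial>P)"
    by (intro nn_integral_cong) (simp add: spread_out space_law)
  also have "\<dots> = (\<integral>\<^sup>+y. \<integral>\<^sup>+\<phi>. J \<phi> y \<partial>P \<partial>lborel)"
    by (rule nn_integral_swap[OF sigma_finite_measure_axioms lborel_sf sets_law sets_lborel]) (intro J_comp; measurable)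
  also have "\<dots> = (\<integral>\<^sup>+y. \<integral>\<^sup>+\<phi>. J (translate y \<phi>) y \<partial>P \<partial>lborel)"
    by (rule nn_integral_cong, rule nn_integral_translate_law[symmetric]) (intro J_comp; measurable)
  also have "\<dots> = (\<integral>\<^sup>+y. \<integral>\<^sup>+\<phi>. H \<phi> y \<partial>P \<partial>lborel)"
    by (intro nn_integral_cong) (simp add: shift space_law)
  also have "\<dots> = (\<integral>\<^sup>+\<phi>. \<integral>\<^sup>+y. H \<phi> y \<partial>lborel \<partial>P)"
    by (rule nn_integral_swap[symmetric, OF sigma_finite_measure_axioms lborel_sf sets_law sets_lborel]) (intro H_comp; measurable)
  also have "\<dots> = (\<integral>\<^sup>+\<phi>. (\<integral>\<^sup>+t. (\<integral>\<^sup>+s. w (translate t \<phi>, s - t) \<partial>K \<phi>) * indicator B t \<partial>\<phi>) * b \<partial>P)"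
    by (intro nn_integral_cong) (simp add: collect space_law)
  also have "\<dots> = ?L * b"
    by (rule nn_integral_multc, unfold measurable_law)
      (intro points borel_measurable_times_ennreal measurable_kernel_integral[OF K] w_comp; measurable)
  finally have "b * ?L = b * ?R" by (simp add: mult.commute)
  then show ?thesis
    using B_pos by (auto simp: ennreal_mult_cancel_left b_def)
qed

text \<open>Let every point \<open>t\<close> of the configuration spread a unit of mass uniformly over the cube of all \<open>s\<close> with
\<open>t - s\<close> in the unit cube. The mass sent out of \<open>B\<close> is the number of points in \<open>B\<close>; the density of the
mass received at \<open>s\<close> is the number of points in the unit cube at \<open>s\<close>, with mean the intensity.\<close>

lemma mean_measure_eq_intensity:
  assumes B [measurable]: "B \<in> sets borel" and B_pos: "0 < emeasure lborel B" "emeasure lborel B < \<infinity>"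
  shows "(\<integral>\<^sup>+\<phi>. emeasure \<phi> B \<partial>P) = (\<integral>\<^sup>+\<phi>. emeasure \<phi> (cbox 0 One) \<partial>P) * emeasure lborel B"
proof -
  define C :: "'a set" where "C = cbox 0 One"
  have C [measurable]: "C \<in> sets borel" by (simp add: C_def)
  have C1: "emeasure lborel C = 1"
    unfolding C_def by (simp add: emeasure_lborel_cbox_eq)
  define w :: "'a measure \<times> 'a \<Rightarrow> ennreal" where "w = (\<lambda>z. indicator C (- snd z))"
  have w: "w \<in> borel_measurable (counting_borel \<Otimes>\<^sub>M borel)"
    unfolding w_def by measurable
  have K: "random_measure counting_borel (\<lambda>_ :: 'a measure. lborel :: 'a measure)"
    unfolding random_measure_def
    by (intro conjI ballI allI emeasure_bounded_finite bounded_cball) simp_all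
  have K_translate: "lborel = translate y (lborel :: 'a measure)" for y
  proof -
    have "(\<lambda>x :: 'a. x - y) = (+) (- y)" by auto
    then show ?thesis by (simp add: translate_def lborel_distr_plus)
  qed
  have "(\<integral>\<^sup>+\<phi>. emeasure \<phi> B \<partial>P) =
      (\<integral>\<^sup>+\<phi>. \<integral>\<^sup>+t. (\<integral>\<^sup>+s. w (translate t \<phi>, s - t) \<partial>lborel) * indicator B t \<partial>\<phi> \<partial>P)"
  proof (rule nn_integral_cong)
    fix \<phi> assume "\<phi> \<in> space P"
    then have "sets \<phi> = sets borel" by (simp add: space_law counting_measureD(1))
    moreover have "(\<integral>\<^sup>+s. w (translate t \<phi>, s - t) \<partial>lborel) = 1" for t
      by (simp add: w_def lborel_indicator_shift(2)[OF C] C1 del: nn_integral_indicator)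
    ultimately show "emeasure \<phi> B = (\<integral>\<^sup>+t. (\<integral>\<^sup>+s. w (translate t \<phi>, s - t) \<partial>lborel) * indicator B t \<partial>\<phi>)"
      by simp
  qed
  also have "\<dots> = (\<integral>\<^sup>+\<phi>. \<integral>\<^sup>+t. \<integral>\<^sup>+s. w (translate t \<phi>, s - t) * indicator B s \<partial>lborel \<partial>\<phi> \<partial>P)"
    by (rule mass_transport[OF K K_translate w B B_pos])
  also have "\<dots> = (\<integral>\<^sup>+\<phi>. \<integral>\<^sup>+s. emeasure (translate s \<phi>) C * indicator B s \<partial>lborel \<partial>P)"
  proof (rule nn_integral_cong)
    fix \<phi> assume "\<phi> \<in> space P"
    then have \<phi>: "\<phi> \<in> counting_measures" by (simp add: space_law)
    note sets_\<phi> = counting_measureD(1)[OF \<phi>]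
    have "(\<integral>\<^sup>+t. \<integral>\<^sup>+s. w (translate t \<phi>, s - t) * indicator B s \<partial>lborel \<partial>\<phi>) =
        (\<integral>\<^sup>+s. \<integral>\<^sup>+t. indicator C (t - s) * indicator B s \<partial>\<phi> \<partial>lborel)"
      unfolding w_def snd_conv minus_diff_eq
      by (rule nn_integral_swap[OF random_measure_sigma_finite[OF sets_\<phi> counting_measureD(3)[OF \<phi>]]
            lborel.sigma_finite_measure_axioms sets_\<phi> sets_lborel]) measurable
    also have "\<dots> = (\<integral>\<^sup>+s. emeasure (translate s \<phi>) C * indicator B s \<partial>lborel)"
    proof (rule nn_integral_cong)
      fix s
      have "(\<integral>\<^sup>+t. indicator C (t - s) * indicator B s \<partial>\<phi>) = (\<integral>\<^sup>+t. indicator C (t - s) \<partial>\<phi>) * indicator B s"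
        by (rule nn_integral_multc) (simp add: measurable_cong_sets[OF sets_\<phi> refl])
      also have "(\<integral>\<^sup>+t. indicator C (t - s) \<partial>\<phi>) = (\<integral>\<^sup>+t. indicator C t \<partial>translate s \<phi>)"
        by (rule nn_integral_translate[OF sets_\<phi>, symmetric]) measurable
      finally show "(\<integral>\<^sup>+t. indicator C (t - s) * indicator B s \<partial>\<phi>) = emeasure (translate s \<phi>) C * indicator B s"
        by simp
    qed
    finally show "(\<integral>\<^sup>+t. \<integral>\<^sup>+s. w (translate t \<phi>, s - t) * indicator B s \<partial>lborel \<partial>\<phi>) =
        (\<integral>\<^sup>+s. emeasure (translate s \<phi>) C * indicator B s \<partial>lborel)" .
  qed
  also have "\<dots> = (\<integral>\<^sup>+s. \<integral>\<^sup>+\<phi>. emeasure (translate s \<phi>) C * indicator B s \<partial>P \<partial>lborel)"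
  proof (rule nn_integral_swap[OF sigma_finite_measure_axioms lborel.sigma_finite_measure_axioms sets_law sets_lborel])
    have "(\<lambda>z. translate (snd z) (fst z)) \<in> counting_borel \<Otimes>\<^sub>M borel \<rightarrow>\<^sub>M (counting_borel :: 'a measure measure)"
      by measurable
    from measurable_compose[OF this measurable_emeasure_counting_borel[OF C]]
    show "(\<lambda>z. emeasure (translate (snd z) (fst z)) C * indicator B (snd z))
        \<in> borel_measurable (counting_borel \<Otimes>\<^sub>M borel)" by measurable
  qed
  also have "\<dots> = (\<integral>\<^sup>+s. (\<integral>\<^sup>+\<phi>. emeasure \<phi> C \<partial>P) * indicator B s \<partial>lborel)"
  proof (rule nn_integral_cong)
    fix s :: 'a
    have "(\<lambda>\<phi>. translate s \<phi>) \<in> counting_borel \<rightarrow>\<^sub>M (counting_borel :: 'a measure measure)"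
      by measurable
    from measurable_compose[OF this measurable_emeasure_counting_borel[OF C]]
    have "(\<integral>\<^sup>+\<phi>. emeasure (translate s \<phi>) C * indicator B s \<partial>P) = (\<integral>\<^sup>+\<phi>. emeasure (translate s \<phi>) C \<partial>P) * indicator B s"
      by (intro nn_integral_multc) (simp add: measurable_law)
    also have "(\<integral>\<^sup>+\<phi>. emeasure (translate s \<phi>) C \<partial>P) = (\<integral>\<^sup>+\<phi>. emeasure \<phi> C \<partial>P)"
      by (rule nn_integral_translate_law[OF measurable_emeasure_counting_borel[OF C]])
    finally show "(\<integral>\<^sup>+\<phi>. emeasure (translate s \<phi>) C * indicator B s \<partial>P) = (\<integral>\<^sup>+\<phi>. emeasure \<phi> C \<partial>P) * indicator B s" .
  qed
  also have "\<dots> = (\<integral>\<^sup>+\<phi>. emeasure \<phi> C \<partial>P) * emeasure lborel B"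
    by (rule nn_integral_cmult_indicator) simp
  finally show ?thesis by (simp add: C_def)
qed

text \<open>The mean of the sum of \<open>h\<close> over the configurations seen from the points in \<open>B\<close>: the Palm integral of \<open>h\<close> before
normalisation.\<close>

definition campbell_integral :: "'a set \<Rightarrow> ('a measure \<Rightarrow> ennreal) \<Rightarrow> ennreal" where
  "campbell_integral B h = (\<integral>\<^sup>+\<phi>. \<integral>\<^sup>+t. h (translate t \<phi>) * indicator B t \<partial>\<phi> \<partial>P)"

lemma measurable_point_integral:
  assumes "h \<in> borel_measurable (counting_borel \<Otimes>\<^sub>M borel)"
  shows "(\<lambda>\<phi> :: 'a measure. \<integral>\<^sup>+t. h (\<phi>, t) \<partial>\<phi>) \<in> borel_measurable counting_borel"
  by (rule measurable_nn_integral_random_measure[OF random_measure_counting assms]) simp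

text \<open>Mass transport between the points of one configuration, read from the origin: \<open>w (\<phi>, x)\<close> is sent from
\<open>0\<close> to \<open>x\<close>, and \<open>w (translate x \<phi>, - x)\<close> is received at \<open>0\<close> from \<open>x\<close>.\<close>

lemma campbell_integral_transport:
  assumes w: "w \<in> borel_measurable (counting_borel \<Otimes>\<^sub>M borel)"
    and B: "B \<in> sets borel" "0 < emeasure lborel B" "emeasure lborel B < \<infinity>"
  shows "campbell_integral B (\<lambda>\<phi>. \<integral>\<^sup>+x. w (\<phi>, x) \<partial>\<phi>) =
    campbell_integral B (\<lambda>\<phi>. \<integral>\<^sup>+x. w (translate x \<phi>, - x) \<partial>\<phi>)"
proof -
  have w_comp: "(\<lambda>z. w (translate (T z) (X z), S z)) \<in> borel_measurable N"
    if "X \<in> N \<rightarrow>\<^sub>M counting_borel" "T \<in> borel_measurable N" "S \<in> borel_measurable N"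
    for X :: "'c \<Rightarrow> 'a measure" and T S N
    by (rule measurable_compose[OF _ w]) (intro measurable_Pair measurable_translate that)
  have sf: "sigma_finite_measure \<phi>" if "\<phi> \<in> counting_measures" for \<phi> :: "'a measure"
    by (intro random_measure_sigma_finite counting_measureD(1,3) that)
  have const: "(\<lambda>_. \<phi>) \<in> N \<rightarrow>\<^sub>M counting_borel" if "\<phi> \<in> counting_measures" for \<phi> :: "'a measure" and N :: "'c measure"
    using that by simp
  have K: "random_measure counting_borel (\<lambda>\<phi> :: 'a measure. \<phi>)"
    by (rule random_measure_counting) simp
  have "campbell_integral B (\<lambda>\<phi>. \<integral>\<^sup>+x. w (\<phi>, x) \<partial>\<phi>) =
      (\<integral>\<^sup>+\<phi>. \<integral>\<^sup>+t. (\<integral>\<^sup>+s. w (translate t \<phi>, s - t) \<partial>\<phi>) * indicator B t \<partial>\<phi> \<partial>P)"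
    unfolding campbell_integral_def
  proof (intro nn_integral_cong)
    fix \<phi> t assume "\<phi> \<in> space P"
    then have \<phi>: "\<phi> \<in> counting_measures" by (simp add: space_law)
    have "(\<integral>\<^sup>+x. w (translate t \<phi>, x) \<partial>translate t \<phi>) = (\<integral>\<^sup>+s. w (translate t \<phi>, s - t) \<partial>\<phi>)"
      by (rule nn_integral_translate[OF counting_measureD(1)[OF \<phi>]]) (intro w_comp const \<phi>; measurable)
    then show "(\<integral>\<^sup>+x. w (translate t \<phi>, x) \<partial>translate t \<phi>) * indicator B t =
        (\<integral>\<^sup>+s. w (translate t \<phi>, s - t) \<partial>\<phi>) * indicator B t" by simp
  qed
  also have "\<dots> = (\<integral>\<^sup>+\<phi>. \<integral>\<^sup>+t. \<integral>\<^sup>+s. w (translate t \<phi>, s - t) * indicator B s \<partial>\<phi> \<partial>\<phi> \<partial>P)"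
    by (rule mass_transport[OF K _ w B]) simp
  also have "\<dots> = campbell_integral B (\<lambda>\<phi>. \<integral>\<^sup>+x. w (translate x \<phi>, - x) \<partial>\<phi>)"
    unfolding campbell_integral_def
  proof (rule nn_integral_cong)
    fix \<phi> assume "\<phi> \<in> space P"
    then have \<phi>: "\<phi> \<in> counting_measures" by (simp add: space_law)
    note sets_\<phi> = counting_measureD(1)[OF \<phi>] and \<phi>' = translate_counting_measures[OF \<phi>]
    note [measurable] = B(1)
    have "(\<integral>\<^sup>+t. \<integral>\<^sup>+s. w (translate t \<phi>, s - t) * indicator B s \<partial>\<phi> \<partial>\<phi>) =
        (\<integral>\<^sup>+s. \<integral>\<^sup>+t. w (translate t \<phi>, s - t) * indicator B s \<partial>\<phi> \<partial>\<phi>)"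
      by (rule nn_integral_swap[OF sf[OF \<phi>] sf[OF \<phi>] sets_\<phi> sets_\<phi>])
        (intro borel_measurable_times_ennreal w_comp const \<phi>; measurable)
    also have "\<dots> = (\<integral>\<^sup>+s. (\<integral>\<^sup>+x. w (translate x (translate s \<phi>), - x) \<partial>translate s \<phi>) * indicator B s \<partial>\<phi>)"
    proof (rule nn_integral_cong)
      fix s
      have "(\<lambda>t. w (translate t \<phi>, s - t)) \<in> borel_measurable borel"
        by (intro w_comp const \<phi>; measurable)
      then have "(\<integral>\<^sup>+t. w (translate t \<phi>, s - t) * indicator B s \<partial>\<phi>) =
          (\<integral>\<^sup>+t. w (translate t \<phi>, s - t) \<partial>\<phi>) * indicator B s"
        by (intro nn_integral_multc) (simp add: measurable_cong_sets[OF sets_\<phi> refl])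
      also have "(\<integral>\<^sup>+t. w (translate t \<phi>, s - t) \<partial>\<phi>) =
          (\<integral>\<^sup>+t. w (translate (t - s) (translate s \<phi>), - (t - s)) \<partial>\<phi>)"
        by (simp add: translate_translate[OF sets_\<phi>])
      also have "\<dots> = (\<integral>\<^sup>+x. w (translate x (translate s \<phi>), - x) \<partial>translate s \<phi>)"
        by (rule nn_integral_translate[OF sets_\<phi>, symmetric]) (intro w_comp const \<phi>'; measurable)
      finally show "(\<integral>\<^sup>+t. w (translate t \<phi>, s - t) * indicator B s \<partial>\<phi>) =
          (\<integral>\<^sup>+x. w (translate x (translate s \<phi>), - x) \<partial>translate s \<phi>) * indicator B s" .
    qed
    finally show "(\<integral>\<^sup>+t. \<integral>\<^sup>+s. w (translate t \<phi>, s - t) * indicator B s \<partial>\<phi> \<partial>\<phi>) =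
        (\<integral>\<^sup>+s. (\<integral>\<^sup>+x. w (translate x (translate s \<phi>), - x) \<partial>translate s \<phi>) * indicator B s \<partial>\<phi>)" .
  qed
  finally show ?thesis .
qed

lemma measurable_campbell_integrand:
  assumes h: "h \<in> borel_measurable counting_borel" and [measurable]: "B \<in> sets borel"
  shows "(\<lambda>\<phi> :: 'a measure. \<integral>\<^sup>+t. h (translate t \<phi>) * indicator B t \<partial>\<phi>) \<in> borel_measurable counting_borel"
proof -
  have "(\<lambda>z. translate (snd z) (fst z)) \<in> counting_borel \<Otimes>\<^sub>M borel \<rightarrow>\<^sub>M (counting_borel :: 'a measure measure)"
    by measurable
  from measurable_compose[OF this h]
  have "(\<lambda>z. h (translate (snd z) (fst z)) * indicator B (snd z)) \<in> borel_measurable (counting_borel \<Otimes>\<^sub>M borel)"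
    by measurable
  from measurable_point_integral[OF this] show ?thesis by simp
qed

end

section \<open>Palm integrals of a stationary point process\<close>

context stationary_point_process
begin

definition law :: "'a measure measure" where
  "law = distr M counting_borel \<Phi>"

lemma measurable_shift: "\<theta> t \<in> M \<rightarrow>\<^sub>M M"
proof -
  have "(\<lambda>\<omega>. (t, \<omega>)) \<in> M \<rightarrow>\<^sub>M borel \<Otimes>\<^sub>M M" by simp
  from measurable_compose[OF this flow_measurable] show ?thesis by simp
qed

lemma nn_integral_law:
  assumes "h \<in> borel_measurable counting_borel"
  shows "(\<integral>\<^sup>+\<phi>. h \<phi> \<partial>law) = (\<integral>\<^sup>+\<omega>. h (\<Phi> \<omega>) \<partial>M)"
  unfolding law_def using process_measurable by (rule nn_integral_distr) (simp add: assms)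

lemma process_counting: "\<omega> \<in> space M \<Longrightarrow> \<Phi> \<omega> \<in> counting_measures"
  using measurable_space[OF process_measurable] by simp

sublocale law: stationary_law law
proof (intro stationary_law.intro stationary_law_axioms.intro)
  show "prob_space law"
    unfolding law_def by (rule prob_space_distr[OF process_measurable])
  show "sets law = sets counting_borel" by (simp add: law_def)
  fix y :: 'a
  have t: "translate y \<in> counting_borel \<rightarrow>\<^sub>M counting_borel"
    by (rule measurable_translate) simp_all
  have "distr law counting_borel (translate y) = distr M counting_borel (translate y \<circ> \<Phi>)"
    unfolding law_def by (rule distr_distr[OF t process_measurable])
  also have "\<dots> = distr M counting_borel (\<Phi> \<circ> \<theta> y)"
    by (rule distr_cong) (simp_all add: process_flow)
  also have "\<dots> = distr (distr M M (\<theta> y)) counting_borel \<Phi>"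
    by (rule distr_distr[OF process_measurable measurable_shift, symmetric])
  also have "\<dots> = law"
    by (simp add: flow_invariant law_def)
  finally show "distr law counting_borel (translate y) = law" .
qed

lemma intensity_law: "intensity M \<Phi> = (\<integral>\<^sup>+\<phi>. emeasure \<phi> (cbox 0 One) \<partial>law)"
  unfolding intensity_def by (rule nn_integral_law[symmetric]) (simp add: measurable_emeasure_counting_borel)

text \<open>The set function in the definition of the Palm probability is countably additive, so it is not replaced
by the default of \<open>measure_of\<close>.\<close>

lemma emeasure_palm_probability:
  assumes [measurable]: "B \<in> sets borel" and A: "A \<in> sets M"
  shows "emeasure (palm_probability M \<theta> \<Phi> B) A =
    (\<integral>\<^sup>+\<omega>. \<integral>\<^sup>+t. indicator A (\<theta> t \<omega>) * indicator B t \<partial>\<Phi> \<omega> \<partial>M) / (intensity M \<Phi> * emeasure lborel B)"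
proof -
  let ?c = "intensity M \<Phi> * emeasure lborel B"
  define \<mu> where "\<mu> A = (\<integral>\<^sup>+\<omega>. \<integral>\<^sup>+t. indicator A (\<theta> t \<omega>) * indicator B t \<partial>\<Phi> \<omega> \<partial>M) / ?c" for A
  have joint: "(\<lambda>z. indicator A (\<theta> (snd z) (fst z)) * indicator B (snd z) :: ennreal) \<in> borel_measurable (M \<Otimes>\<^sub>M borel)"
    if [measurable]: "A \<in> sets M" for A
  proof -
    have "(\<lambda>z. (snd z, fst z)) \<in> M \<Otimes>\<^sub>M borel \<rightarrow>\<^sub>M borel \<Otimes>\<^sub>M M" by measurable
    from measurable_compose[OF this flow_measurable]
    have [measurable]: "(\<lambda>z. \<theta> (snd z) (fst z)) \<in> M \<Otimes>\<^sub>M borel \<rightarrow>\<^sub>M M" by simp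
    show ?thesis by measurable
  qed
  have slice: "(\<lambda>t. indicator A (\<theta> t \<omega>) * indicator B t :: ennreal) \<in> borel_measurable (\<Phi> \<omega>)"
    if "A \<in> sets M" "\<omega> \<in> space M" for A \<omega>
    unfolding measurable_cong_sets[OF counting_measureD(1)[OF process_counting[OF that(2)]] refl]
    using measurable_Pair2[OF joint[OF that(1)] that(2)] by simp
  have inner: "(\<lambda>\<omega>. \<integral>\<^sup>+t. indicator A (\<theta> t \<omega>) * indicator B t \<partial>\<Phi> \<omega>) \<in> borel_measurable M"
    if "A \<in> sets M" for A
    using measurable_nn_integral_random_measure[OF random_measure_counting[OF process_measurable] joint[OF that]]
    by simp
  have "emeasure (palm_probability M \<theta> \<Phi> B) A = \<mu> A"
  proof (rule emeasure_measure_of)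
    show "palm_probability M \<theta> \<Phi> B = measure_of (space M) (sets M) \<mu>"
      by (simp add: palm_probability_def \<mu>_def[abs_def])
    show "positive (sets (palm_probability M \<theta> \<Phi> B)) \<mu>"
      by (simp add: positive_def \<mu>_def)
    show "countably_additive (sets (palm_probability M \<theta> \<Phi> B)) \<mu>"
    proof (rule countably_additiveI)
      fix F :: "nat \<Rightarrow> 'w set"
      assume "range F \<subseteq> sets (palm_probability M \<theta> \<Phi> B)" and disj: "disjoint_family F"
      then have F: "F i \<in> sets M" for i by (auto simp: palm_probability_def)
      have "(\<Sum>i. \<mu> (F i)) = (\<Sum>i. \<integral>\<^sup>+\<omega>. \<integral>\<^sup>+t. indicator (F i) (\<theta> t \<omega>) * indicator B t \<partial>\<Phi> \<omega> \<partial>M) / ?c"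
        by (simp add: \<mu>_def)
      also have "(\<Sum>i. \<integral>\<^sup>+\<omega>. \<integral>\<^sup>+t. indicator (F i) (\<theta> t \<omega>) * indicator B t \<partial>\<Phi> \<omega> \<partial>M) =
          (\<integral>\<^sup>+\<omega>. (\<Sum>i. \<integral>\<^sup>+t. indicator (F i) (\<theta> t \<omega>) * indicator B t \<partial>\<Phi> \<omega>) \<partial>M)"
        by (rule nn_integral_suminf[symmetric]) (rule inner[OF F])
      also have "\<dots> = (\<integral>\<^sup>+\<omega>. \<integral>\<^sup>+t. indicator (\<Union>i. F i) (\<theta> t \<omega>) * indicator B t \<partial>\<Phi> \<omega> \<partial>M)"
      proof (rule nn_integral_cong)
        fix \<omega> assume \<omega>: "\<omega> \<in> space M"
        have "(\<Sum>i. \<integral>\<^sup>+t. indicator (F i) (\<theta> t \<omega>) * indicator B t \<partial>\<Phi> \<omega>) =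
            (\<integral>\<^sup>+t. (\<Sum>i. indicator (F i) (\<theta> t \<omega>) * indicator B t) \<partial>\<Phi> \<omega>)"
          by (rule nn_integral_suminf[symmetric]) (rule slice[OF F \<omega>])
        also have "\<dots> = (\<integral>\<^sup>+t. indicator (\<Union>i. F i) (\<theta> t \<omega>) * indicator B t \<partial>\<Phi> \<omega>)"
          by (simp only: ennreal_suminf_multc suminf_indicator[OF disj])
        finally show "(\<Sum>i. \<integral>\<^sup>+t. indicator (F i) (\<theta> t \<omega>) * indicator B t \<partial>\<Phi> \<omega>) =
            (\<integral>\<^sup>+t. indicator (\<Union>i. F i) (\<theta> t \<omega>) * indicator B t \<partial>\<Phi> \<omega>)" .
      qed
      finally show "(\<Sum>i. \<mu> (F i)) = \<mu> (\<Union>i. F i)" by (simp add: \<mu>_def)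
    qed
  qed (use A sets.space_closed in \<open>auto simp: palm_probability_def\<close>)
  then show ?thesis by (simp add: \<mu>_def)
qed

lemma sets_palm_probability [simp]: "sets (palm_probability M \<theta> \<Phi> B) = sets M"
  and space_palm_probability [simp]: "space (palm_probability M \<theta> \<Phi> B) = space M"
  by (simp_all add: palm_probability_def)

text \<open>Equivariance of \<open>\<Phi>\<close> turns the flow on the probability space into translation of configurations, so
that the distribution of \<open>\<Phi>\<close> under the Palm probability depends only on the law of \<open>\<Phi>\<close>.\<close>

lemma nn_integral_distr_palm:
  assumes B: "B \<in> sets borel" and h: "h \<in> borel_measurable counting_borel"
  shows "(\<integral>\<^sup>+\<phi>. h \<phi> \<partial>distr (palm_probability M \<theta> \<Phi> B) counting_borel \<Phi>) =
    law.campbell_integral B h / (intensity M \<Phi> * emeasure lborel B)"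
proof -
  let ?c = "intensity M \<Phi> * emeasure lborel B"
  let ?D = "distr (palm_probability M \<theta> \<Phi> B) counting_borel \<Phi>"
  have \<Phi>: "\<Phi> \<in> palm_probability M \<theta> \<Phi> B \<rightarrow>\<^sub>M counting_borel"
    using process_measurable measurable_cong_sets[OF sets_palm_probability refl] by blast
  note inner = law.measurable_campbell_integrand[OF _ B]
  have joint: "(\<lambda>t. u (translate t \<phi>) * indicator B t) \<in> borel_measurable \<phi>"
    if u: "u \<in> borel_measurable counting_borel" and \<phi>: "\<phi> \<in> counting_measures" for u :: "'a measure \<Rightarrow> ennreal" and \<phi>
  proof -
    have "(\<lambda>t. translate t \<phi>) \<in> borel \<rightarrow>\<^sub>M counting_borel"
      using \<phi> by (intro measurable_translate) simp_all
    from measurable_compose[OF this u] B show ?thesis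
      by (simp add: measurable_cong_sets[OF counting_measureD(1)[OF \<phi>] refl])
  qed
  have inner': "(\<lambda>\<phi>. \<integral>\<^sup>+t. u (translate t \<phi>) * indicator B t \<partial>\<phi>) \<in> borel_measurable law"
    if "u \<in> borel_measurable counting_borel" for u
    unfolding law.measurable_law using that by (rule inner)
  from h show ?thesis
  proof (induction rule: borel_measurable_induct)
    case (cong f g)
    have "law.campbell_integral B f = law.campbell_integral B g"
      unfolding law.campbell_integral_def
      using cong(3) by (intro nn_integral_cong) (simp add: law.space_law translate_counting_measures)
    moreover have "(\<integral>\<^sup>+\<phi>. f \<phi> \<partial>?D) = (\<integral>\<^sup>+\<phi>. g \<phi> \<partial>?D)"
      using cong(3) by (intro nn_integral_cong) simp
    ultimately show ?case using cong(4) by simp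
  next
    case (set A)
    have \<Phi>A: "\<Phi> -` A \<inter> space M \<in> sets M" by (rule measurable_sets[OF process_measurable set])
    have "(\<integral>\<^sup>+\<phi>. indicator A \<phi> \<partial>?D) = emeasure (palm_probability M \<theta> \<Phi> B) (\<Phi> -` A \<inter> space M)"
      using set \<Phi> by (simp add: emeasure_distr)
    also have "\<dots> = (\<integral>\<^sup>+\<omega>. \<integral>\<^sup>+t. indicator (\<Phi> -` A \<inter> space M) (\<theta> t \<omega>) * indicator B t \<partial>\<Phi> \<omega> \<partial>M) / ?c"
      by (rule emeasure_palm_probability[OF B \<Phi>A])
    also have "(\<integral>\<^sup>+\<omega>. \<integral>\<^sup>+t. indicator (\<Phi> -` A \<inter> space M) (\<theta> t \<omega>) * indicator B t \<partial>\<Phi> \<omega> \<partial>M) =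
        (\<integral>\<^sup>+\<omega>. \<integral>\<^sup>+t. indicator A (translate t (\<Phi> \<omega>)) * indicator B t \<partial>\<Phi> \<omega> \<partial>M)"
    proof (intro nn_integral_cong)
      fix \<omega> t assume \<omega>: "\<omega> \<in> space M"
      then have "\<theta> t \<omega> \<in> space M" using measurable_space[OF measurable_shift] by blast
      then show "indicator (\<Phi> -` A \<inter> space M) (\<theta> t \<omega>) * indicator B t =
          indicator A (translate t (\<Phi> \<omega>)) * (indicator B t :: ennreal)"
        by (simp add: indicator_def process_flow[OF \<omega>])
    qed
    also have "\<dots> = law.campbell_integral B (indicator A)"
      unfolding law.campbell_integral_def using set
      by (intro nn_integral_law[symmetric] inner) simp
    finally show ?case .
  next
    case (mult u c)
    have "law.campbell_integral B (\<lambda>x. c * u x) =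
        (\<integral>\<^sup>+\<phi>. c * (\<integral>\<^sup>+t. u (translate t \<phi>) * indicator B t \<partial>\<phi>) \<partial>law)"
      unfolding law.campbell_integral_def
    proof (rule nn_integral_cong)
      fix \<phi> assume "\<phi> \<in> space law"
      then have "\<phi> \<in> counting_measures" by (simp add: law.space_law)
      from nn_integral_cmult[OF joint[OF mult(2) this], of c]
      show "(\<integral>\<^sup>+t. c * u (translate t \<phi>) * indicator B t \<partial>\<phi>) =
          c * (\<integral>\<^sup>+t. u (translate t \<phi>) * indicator B t \<partial>\<phi>)"
        by (simp only: mult.assoc)
    qed
    also have "\<dots> = c * law.campbell_integral B u"
      unfolding law.campbell_integral_def by (rule nn_integral_cmult[OF inner'[OF mult(2)]])
    finally have "law.campbell_integral B (\<lambda>x. c * u x) = c * law.campbell_integral B u" .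
    moreover have "(\<integral>\<^sup>+\<phi>. c * u \<phi> \<partial>?D) = c * (\<integral>\<^sup>+\<phi>. u \<phi> \<partial>?D)"
      using mult(2) by (intro nn_integral_cmult) simp
    ultimately show ?case using mult(4) by (simp add: ennreal_times_divide)
  next
    case (add u v)
    have "law.campbell_integral B (\<lambda>x. v x + u x) =
        (\<integral>\<^sup>+\<phi>. (\<integral>\<^sup>+t. v (translate t \<phi>) * indicator B t \<partial>\<phi>) +
          (\<integral>\<^sup>+t. u (translate t \<phi>) * indicator B t \<partial>\<phi>) \<partial>law)"
      unfolding law.campbell_integral_def
    proof (rule nn_integral_cong)
      fix \<phi> assume "\<phi> \<in> space law"
      then have \<phi>: "\<phi> \<in> counting_measures" by (simp add: law.space_law)
      from nn_integral_add[OF joint[OF add(3) \<phi>] joint[OF add(1) \<phi>]]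
      show "(\<integral>\<^sup>+t. (v (translate t \<phi>) + u (translate t \<phi>)) * indicator B t \<partial>\<phi>) =
          (\<integral>\<^sup>+t. v (translate t \<phi>) * indicator B t \<partial>\<phi>) +
          (\<integral>\<^sup>+t. u (translate t \<phi>) * indicator B t \<partial>\<phi>)"
        by (simp only: distrib_right)
    qed
    also have "\<dots> = law.campbell_integral B v + law.campbell_integral B u"
      unfolding law.campbell_integral_def
      by (rule nn_integral_add[OF inner'[OF add(3)] inner'[OF add(1)]])
    finally have "law.campbell_integral B (\<lambda>x. v x + u x) =
        law.campbell_integral B v + law.campbell_integral B u" .
    moreover have "(\<integral>\<^sup>+\<phi>. v \<phi> + u \<phi> \<partial>?D) = (\<integral>\<^sup>+\<phi>. v \<phi> \<partial>?D) + (\<integral>\<^sup>+\<phi>. u \<phi> \<partial>?D)"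
      using add by (intro nn_integral_add) simp_all
    ultimately show ?case using add by (simp add: add_divide_distrib_ennreal)
  next
    case (seq U)
    have sup_D: "(\<integral>\<^sup>+\<phi>. (SUP i. U i) \<phi> \<partial>?D) = (SUP i. \<integral>\<^sup>+\<phi>. U i \<phi> \<partial>?D)"
      unfolding SUP_apply using seq by (intro nn_integral_monotone_convergence_SUP) simp_all
    have sup_C: "law.campbell_integral B (SUP i. U i) = (SUP i. law.campbell_integral B (U i))"
    proof -
      have mono: "U i \<phi> \<le> U j \<phi>" if "i \<le> j" for i j \<phi>
        using seq(3) that by (auto simp: incseq_def le_fun_def)
      have "law.campbell_integral B (SUP i. U i) =
          (\<integral>\<^sup>+\<phi>. (SUP i. \<integral>\<^sup>+t. U i (translate t \<phi>) * indicator B t \<partial>\<phi>) \<partial>law)"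
        unfolding law.campbell_integral_def
      proof (rule nn_integral_cong)
        fix \<phi> assume "\<phi> \<in> space law"
        then have \<phi>: "\<phi> \<in> counting_measures" by (simp add: law.space_law)
        have "(\<integral>\<^sup>+t. (SUP i. U i) (translate t \<phi>) * indicator B t \<partial>\<phi>) =
            (\<integral>\<^sup>+t. (SUP i. U i (translate t \<phi>) * indicator B t) \<partial>\<phi>)"
          by (simp add: SUP_apply SUP_mult_right_ennreal image_image)
        also have "\<dots> = (SUP i. \<integral>\<^sup>+t. U i (translate t \<phi>) * indicator B t \<partial>\<phi>)"
          by (rule nn_integral_monotone_convergence_SUP)
            (auto simp: incseq_def le_fun_def intro!: mult_right_mono mono joint seq(1) \<phi>)
        finally show "(\<integral>\<^sup>+t. (SUP i. U i) (translate t \<phi>) * indicator B t \<partial>\<phi>) =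
            (SUP i. \<integral>\<^sup>+t. U i (translate t \<phi>) * indicator B t \<partial>\<phi>)" .
      qed
      also have "\<dots> = (SUP i. law.campbell_integral B (U i))"
        unfolding law.campbell_integral_def
        by (rule nn_integral_monotone_convergence_SUP)
          (auto simp: incseq_def le_fun_def intro!: nn_integral_mono mult_right_mono mono inner' seq(1))
      finally show ?thesis .
    qed
    have "(\<integral>\<^sup>+\<phi>. (SUP i. U i) \<phi> \<partial>?D) = (SUP i. law.campbell_integral B (U i) / ?c)"
      unfolding sup_D by (simp only: seq.IH)
    also have "\<dots> = law.campbell_integral B (SUP i. U i) / ?c"
      unfolding sup_C divide_ennreal_def by (rule SUP_mult_right_ennreal[symmetric])
    finally show ?case .
  qed
qed

end

section \<open>Mass sent and received by the origin\<close>

context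
  fixes f :: "'a::euclidean_space measure \<Rightarrow> 'a"
  assumes f: "point_map f"
begin

text \<open>The mass that leaves the origin: it all goes to the single point \<open>orbit f n \<phi>\<close>.\<close>

lemma nn_integral_transport_out:
  assumes \<phi>: "\<phi> \<in> counting_measures0"
  shows "(\<integral>\<^sup>+x. transport f n G (\<phi>, x) \<partial>\<phi>) =
    emeasure \<phi> {orbit f n \<phi>} * indicator G ((map_translate f ^^ n) \<phi>)"
proof -
  have sets_\<phi>: "sets \<phi> = sets borel"
    using \<phi> counting_measures0_subset counting_measureD(1) by blast
  have "(\<integral>\<^sup>+x. transport f n G (\<phi>, x) \<partial>\<phi>) =
      (\<integral>\<^sup>+x. indicator G ((map_translate f ^^ n) \<phi>) * indicator {orbit f n \<phi>} x \<partial>\<phi>)"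
    using \<phi> by (intro nn_integral_cong)
      (auto simp: transport_def indicator_def map_translate_iterate_eq_orbit[OF sets_\<phi>])
  also have "\<dots> = indicator G ((map_translate f ^^ n) \<phi>) * emeasure \<phi> {orbit f n \<phi>}"
    by (rule nn_integral_cmult_indicator) (simp add: sets_\<phi>)
  finally show ?thesis by (simp add: mult.commute)
qed

text \<open>For \<open>\<phi>\<close> in \<open>G\<close>, the origin receives mass from \<open>x\<close> exactly when \<open>x\<close> is an \<open>n\<close>-th preimage of it, because the orbit of
\<open>x\<close> is \<open>x\<close> plus the orbit of the origin in the configuration seen from \<open>x\<close>.\<close>

lemma transport_in:
  assumes \<phi>: "\<phi> \<in> counting_measures"
  shows "transport f n G (translate x \<phi>, - x) = indicator G \<phi> * indicator (preimages f n \<phi> 0) x"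
  unfolding transport_def preimages_def
  by (auto simp: indicator_def translate_counting_measures0[OF \<phi>] translate_translate
      counting_measureD(1)[OF \<phi>] translate_0 point_shift_iterate_eq_orbit eq_neg_iff_add_eq_0 add.commute)

lemma sets_preimages:
  assumes \<phi>: "\<phi> \<in> counting_measures"
  shows "preimages f n \<phi> 0 \<in> sets borel"
proof -
  have "counting_measures \<in> sets (counting_borel :: 'a measure measure)"
    using sets.top[of counting_borel] by simp
  note w = measurable_transport[OF f this, of n]
  have "(\<lambda>x. (translate x \<phi>, - x)) \<in> borel \<rightarrow>\<^sub>M counting_borel \<Otimes>\<^sub>M borel"
    using \<phi> by (intro measurable_Pair measurable_translate) simp_all
  from measurable_compose[OF this w]
  have "(\<lambda>x. indicator (preimages f n \<phi> 0) x :: ennreal) \<in> borel_measurable borel"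
    by (simp add: transport_in[OF \<phi>] \<phi>)
  then show ?thesis by (simp add: borel_measurable_indicator_iff)
qed

lemma nn_integral_transport_in:
  assumes \<phi>: "\<phi> \<in> counting_measures"
  shows "(\<integral>\<^sup>+x. transport f n G (translate x \<phi>, - x) \<partial>\<phi>) = preimage_mass f n \<phi> 0 * indicator G \<phi>"
proof -
  have "(\<integral>\<^sup>+x. transport f n G (translate x \<phi>, - x) \<partial>\<phi>) = indicator G \<phi> * emeasure \<phi> (preimages f n \<phi> 0)"
    unfolding transport_in[OF \<phi>]
    by (rule nn_integral_cmult_indicator) (simp add: counting_measureD(1)[OF \<phi>] sets_preimages[OF \<phi>])
  then show ?thesis by (simp add: preimage_mass_def mult.commute)
qed

lemma measurable_transport_integrals:
  assumes G: "G \<in> sets counting_borel"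
  shows "(\<lambda>\<phi>. \<integral>\<^sup>+x. transport f n G (\<phi>, x) \<partial>\<phi>) \<in> borel_measurable counting_borel"
    and "(\<lambda>\<phi>. \<integral>\<^sup>+x. transport f n G (translate x \<phi>, - x) \<partial>\<phi>) \<in> borel_measurable counting_borel"
proof -
  note w = measurable_transport[OF f G, of n]
  have K: "random_measure counting_borel (\<lambda>\<phi> :: 'a measure. \<phi>)"
    by (rule random_measure_counting) simp
  show "(\<lambda>\<phi>. \<integral>\<^sup>+x. transport f n G (\<phi>, x) \<partial>\<phi>) \<in> borel_measurable counting_borel"
    by (rule measurable_nn_integral_random_measure[OF K w])
  have "(\<lambda>z. (translate (snd z) (fst z), - snd z)) \<in>
      counting_borel \<Otimes>\<^sub>M borel \<rightarrow>\<^sub>M (counting_borel :: 'a measure measure) \<Otimes>\<^sub>M borel"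
    by measurable
  from measurable_nn_integral_random_measure[OF K measurable_compose[OF this w]]
  show "(\<lambda>\<phi>. \<integral>\<^sup>+x. transport f n G (translate x \<phi>, - x) \<partial>\<phi>) \<in> borel_measurable counting_borel"
    by simp
qed

end

locale nondegenerate_process = stationary_point_process M \<theta> \<Phi>
  for M :: "'w measure" and \<theta> :: "'a::euclidean_space \<Rightarrow> 'w \<Rightarrow> 'w" and \<Phi> +
  fixes B :: "'a set"
  assumes intensity_pos: "0 < intensity M \<Phi>" and intensity_finite: "intensity M \<Phi> < \<infinity>"
    and B: "B \<in> sets borel" and B_pos: "0 < emeasure lborel B" and B_finite: "emeasure lborel B < \<infinity>"
begin

abbreviation "Palm \<equiv> palm_distribution M \<theta> \<Phi> B"

lemma sets_palm: "sets Palm = sets counting_borel0"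
  by (simp add: palm_distribution_def counting_borel0_def sets_restrict_space)

lemma space_palm: "space Palm = counting_measures0"
  using sets_eq_imp_space_eq[OF sets_palm] by simp

lemma measurable_palm: "h \<in> borel_measurable counting_borel \<Longrightarrow> h \<in> borel_measurable Palm"
  unfolding measurable_cong_sets[OF sets_palm refl]
  by (rule measurable_compose[OF measurable_counting_borel0_borel])

text \<open>Restricting to configurations with a point at the origin loses nothing, since almost every point with
respect to a counting measure is an atom of it.\<close>

lemma nn_integral_palm:
  assumes h: "h \<in> borel_measurable counting_borel"
  shows "(\<integral>\<^sup>+\<phi>. h \<phi> \<partial>Palm) = law.campbell_integral B h / (intensity M \<Phi> * emeasure lborel B)"
proof -
  have "(\<integral>\<^sup>+\<phi>. h \<phi> \<partial>Palm) =
      (\<integral>\<^sup>+\<phi>. h \<phi> * indicator counting_measures0 \<phi> \<partial>distr (palm_probability M \<theta> \<Phi> B) counting_borel \<Phi>)"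
    unfolding palm_distribution_def
    by (rule nn_integral_restrict_space)
      (simp add: Int_absorb2[OF counting_measures0_subset] sets_counting_measures0)
  also have "\<dots> = law.campbell_integral B (\<lambda>\<phi>. h \<phi> * indicator counting_measures0 \<phi>) /
      (intensity M \<Phi> * emeasure lborel B)"
    by (intro nn_integral_distr_palm B borel_measurable_times_ennreal h borel_measurable_indicator
        sets_counting_measures0)
  also have "law.campbell_integral B (\<lambda>\<phi>. h \<phi> * indicator counting_measures0 \<phi>) = law.campbell_integral B h"
    unfolding law.campbell_integral_def
  proof (rule nn_integral_cong)
    fix \<phi> assume "\<phi> \<in> space law"
    then have \<phi>: "\<phi> \<in> counting_measures" by (simp add: law.space_law)
    show "(\<integral>\<^sup>+t. h (translate t \<phi>) * indicator counting_measures0 (translate t \<phi>) * indicator B t \<partial>\<phi>) =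
        (\<integral>\<^sup>+t. h (translate t \<phi>) * indicator B t \<partial>\<phi>)"
      using AE_atom[OF \<phi>]
      by (intro nn_integral_cong_AE) (auto elim!: eventually_mono simp: translate_counting_measures0[OF \<phi>])
  qed
  finally show ?thesis .
qed

lemma prob_space_palm: "prob_space Palm"
proof
  let ?c = "intensity M \<Phi> * emeasure lborel B"
  have "emeasure Palm (space Palm) = (\<integral>\<^sup>+\<phi>. 1 \<partial>Palm)" by simp
  also have "\<dots> = law.campbell_integral B (\<lambda>_. 1) / ?c"
    by (rule nn_integral_palm) simp
  also have "law.campbell_integral B (\<lambda>_. 1) = (\<integral>\<^sup>+\<phi>. emeasure \<phi> B \<partial>law)"
    unfolding law.campbell_integral_def using B
    by (intro nn_integral_cong) (simp add: law.space_law counting_measureD(1))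
  also have "\<dots> = ?c"
    by (simp add: law.mean_measure_eq_intensity[OF B B_pos B_finite] intensity_law)
  also have "?c / ?c = 1"
    using intensity_pos intensity_finite B_pos B_finite
    by (intro ennreal_divide_self) (auto simp: ennreal_mult_less_top)
  finally show "emeasure Palm (space Palm) = 1" .
qed

text \<open>Simplicity is invariant under translation, so it passes from the law to the Palm distribution. To have
a measurable description of it, let \<open>h\<close> be the total mass of the multiple points of a configuration.\<close>

lemma AE_palm_simple:
  assumes "simple_process M \<Phi>"
  shows "AE \<phi> in Palm. \<forall>x. emeasure \<phi> {x} \<le> 1"
proof -
  define h :: "'a measure \<Rightarrow> ennreal" where
    "h \<phi> = (\<integral>\<^sup>+x. of_bool (1 < emeasure (translate x \<phi>) {0}) \<partial>\<phi>)" for \<phi>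
  have h: "h \<in> borel_measurable counting_borel"
  proof -
    have "(\<lambda>z. translate (snd z) (fst z)) \<in> counting_borel \<Otimes>\<^sub>M borel \<rightarrow>\<^sub>M (counting_borel :: 'a measure measure)"
      by measurable
    from measurable_compose[OF this measurable_emeasure_counting_borel[of "{0}"]]
    have [measurable]: "(\<lambda>z. emeasure (translate (snd z) (fst z)) {0 :: 'a}) \<in> borel_measurable (counting_borel \<Otimes>\<^sub>M borel)"
      by simp
    have "(\<lambda>z. of_bool (1 < emeasure (translate (snd z) (fst z)) {0 :: 'a}) :: ennreal)
        \<in> borel_measurable (counting_borel \<Otimes>\<^sub>M borel)"
      by measurable
    from law.measurable_point_integral[OF this] show ?thesis by (simp add: h_def[abs_def])
  qed
  have h_simple: "h (translate t (\<Phi> \<omega>)) = 0"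
    if \<omega>: "\<omega> \<in> space M" and simple: "\<forall>x. emeasure (\<Phi> \<omega>) {x} \<le> 1" for \<omega> t
    using simple counting_measureD(1)[OF process_counting[OF \<omega>]]
    by (simp add: h_def translate_translate emeasure_translate_singleton not_less[symmetric])
  have "law.campbell_integral B h =
      (\<integral>\<^sup>+\<omega>. \<integral>\<^sup>+t. h (translate t (\<Phi> \<omega>)) * indicator B t \<partial>\<Phi> \<omega> \<partial>M)"
    unfolding law.campbell_integral_def
    by (rule nn_integral_law[OF law.measurable_campbell_integrand[OF h B]])
  also have "\<dots> = (\<integral>\<^sup>+\<omega>. 0 \<partial>M)"
    using assms AE_space unfolding simple_process_def
    by (intro nn_integral_cong_AE, eventually_elim) (simp add: h_simple)
  finally have "(\<integral>\<^sup>+\<phi>. h \<phi> \<partial>Palm) = 0"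
    by (simp add: nn_integral_palm[OF h])
  then have "AE \<phi> in Palm. h \<phi> = 0"
    using nn_integral_0_iff_AE[OF measurable_palm[OF h]] by simp
  then show ?thesis
    using AE_space
  proof eventually_elim
    case (elim \<phi>)
    then have \<phi>: "\<phi> \<in> counting_measures" using space_palm counting_measures0_subset by auto
    note sets_\<phi> = counting_measureD(1)[OF \<phi>]
    show ?case
    proof (intro allI, rule ccontr)
      fix x assume x: "\<not> emeasure \<phi> {x} \<le> 1"
      have "emeasure \<phi> {x} = (\<integral>\<^sup>+y. indicator {x} y \<partial>\<phi>)" by (simp add: sets_\<phi>)
      also have "\<dots> \<le> h \<phi>"
        unfolding h_def using x
        by (intro nn_integral_mono) (auto simp: indicator_def emeasure_translate_singleton[OF sets_\<phi>])
      finally show False using x elim(1) by simp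
    qed
  qed
qed

context
  fixes f :: "'a measure \<Rightarrow> 'a"
  assumes simple: "simple_process M \<Phi>" and f: "point_map f"
begin

lemma measurable_preimage_mass: "(\<lambda>\<phi>. preimage_mass f n \<phi> 0) \<in> borel_measurable Palm"
proof -
  have "counting_measures0 \<in> sets (counting_borel :: 'a measure measure)"
    by (rule sets_counting_measures0)
  from measurable_palm[OF measurable_transport_integrals(2)[OF f this, of n]]
  show ?thesis
    by (rule measurable_cong[THEN iffD1, rotated])
      (use counting_measures0_subset in \<open>auto simp: space_palm nn_integral_transport_in[OF f]\<close>)
qed

text \<open>The received mass is \<open>m_n 1_G\<close>; the sent mass is the multiplicity of the point
\<open>orbit f n \<phi>\<close>, which is one almost surely, on the event that the shifted configuration lies in \<open>G\<close>.\<close>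

theorem preimage_mass_eq_image_palm:
  assumes G: "G \<in> sets counting_borel0"
  shows "(\<integral>\<^sup>+\<phi>. preimage_mass f n \<phi> 0 * indicator G \<phi> \<partial>Palm) = emeasure (image_palm f Palm n) G"
proof -
  have G': "G \<in> sets counting_borel" using G by (simp add: sets_counting_borel0)
  note w = measurable_transport[OF f G', of n]
  have "(\<integral>\<^sup>+\<phi>. preimage_mass f n \<phi> 0 * indicator G \<phi> \<partial>Palm) =
      (\<integral>\<^sup>+\<phi>. (\<integral>\<^sup>+x. transport f n G (translate x \<phi>, - x) \<partial>\<phi>) \<partial>Palm)"
    using counting_measures0_subset
    by (intro nn_integral_cong) (auto simp: space_palm nn_integral_transport_in[OF f])
  also have "\<dots> = (\<integral>\<^sup>+\<phi>. (\<integral>\<^sup>+x. transport f n G (\<phi>, x) \<partial>\<phi>) \<partial>Palm)"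
    using law.campbell_integral_transport[OF w B B_pos B_finite]
    by (simp add: nn_integral_palm measurable_transport_integrals[OF f G'])
  also have "\<dots> = (\<integral>\<^sup>+\<phi>. indicator G ((map_translate f ^^ n) \<phi>) \<partial>Palm)"
  proof (rule nn_integral_cong_AE)
    from AE_palm_simple[OF simple] AE_space
    show "AE \<phi> in Palm. (\<integral>\<^sup>+x. transport f n G (\<phi>, x) \<partial>\<phi>) = indicator G ((map_translate f ^^ n) \<phi>)"
    proof eventually_elim
      case (elim \<phi>)
      then have \<phi>: "\<phi> \<in> counting_measures0" by (simp add: space_palm)
      then have "1 \<le> emeasure \<phi> {orbit f n \<phi>}"
        using counting_measures0_subset orbit_atom[OF f \<phi>] by (intro counting_measure_atom_ge_1) auto
      with elim(1) have "emeasure \<phi> {orbit f n \<phi>} = 1" by (intro antisym) auto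
      then show ?case by (simp add: nn_integral_transport_out[OF f \<phi>])
    qed
  qed
  also have "\<dots> = (\<integral>\<^sup>+\<phi>. indicator G \<phi> \<partial>image_palm f Palm n)"
    unfolding image_palm_def
    using measurable_map_translate_iterate[OF f, of n] G
    by (intro nn_integral_distr[symmetric]) (simp_all add: measurable_cong_sets[OF sets_palm refl])
  also have "\<dots> = emeasure (image_palm f Palm n) G"
    using G by (intro nn_integral_indicator) (simp add: image_palm_def)
  finally show ?thesis .
qed

corollary nn_integral_preimage_mass: "(\<integral>\<^sup>+\<phi>. preimage_mass f n \<phi> 0 \<partial>Palm) = 1"
proof -
  have T: "(map_translate f ^^ n) \<in> Palm \<rightarrow>\<^sub>M counting_borel0"
    using measurable_map_translate_iterate[OF f] by (simp add: measurable_cong_sets[OF sets_palm refl])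
  have "prob_space (image_palm f Palm n)"
    unfolding image_palm_def by (rule prob_space.prob_space_distr[OF prob_space_palm T])
  then have "emeasure (image_palm f Palm n) counting_measures0 = 1"
    using prob_space.emeasure_space_1[of "image_palm f Palm n"] by (simp add: image_palm_def)
  moreover have "counting_measures0 \<in> sets (counting_borel0 :: 'a measure measure)"
    using sets.top[of counting_borel0] by simp
  ultimately have "(\<integral>\<^sup>+\<phi>. preimage_mass f n \<phi> 0 * indicator counting_measures0 \<phi> \<partial>Palm) = 1"
    by (simp add: preimage_mass_eq_image_palm)
  also have "(\<integral>\<^sup>+\<phi>. preimage_mass f n \<phi> 0 * indicator counting_measures0 \<phi> \<partial>Palm) =
      (\<integral>\<^sup>+\<phi>. preimage_mass f n \<phi> 0 \<partial>Palm)"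
    by (intro nn_integral_cong) (simp add: space_palm)
  finally show ?thesis .
qed

end

end

section \<open>Conditioning on positive mass\<close>

text \<open>If \<open>X \<ge> 0\<close> has mean one, its mean given \<open>X > 0\<close> is \<open>1 / p\<close> with \<open>p\<close> the probability of \<open>X > 0\<close>. Normalising \<open>X\<close>
by \<open>1 / p\<close> cancels the factor \<open>1 / p\<close> of the conditioning, and off the event \<open>X\<close> vanishes anyway.\<close>

lemma size_biased_event_expectation:
  assumes "prob_space M" and X [measurable]: "X \<in> borel_measurable M" and G [measurable]: "G \<in> sets M"
    and mean: "(\<integral>\<^sup>+x. X x \<partial>M) = 1" and A: "A = {x \<in> space M. X x > 0}"
  shows "event_expectation M A (\<lambda>x. X x / event_expectation M A X * indicator G x) =
    (\<integral>\<^sup>+x. X x * indicator G x \<partial>M)"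
proof -
  interpret prob_space M by fact
  have A_sets [measurable]: "A \<in> sets M" unfolding A by measurable
  define p where "p = emeasure M A"
  have "p \<noteq> 0"
  proof
    assume "p = 0"
    then have "AE x in M. x \<notin> A"
      using A_sets by (intro AE_not_in) (simp add: p_def null_sets_def)
    then have "AE x in M. X x = 0"
      using AE_space by eventually_elim (auto simp: A)
    then have "(\<integral>\<^sup>+x. X x \<partial>M) = 0" by (simp add: nn_integral_0_iff_AE)
    with mean show False by simp
  qed
  have "p < \<infinity>" by (simp add: p_def less_top[symmetric])
  have off_A: "Y * X x * indicator A x = Y * X x" if "x \<in> space M" for x Y
    using that by (cases "X x = 0") (auto simp: A indicator_def zero_less_iff_neq_zero)
  have expect: "event_expectation M A X = 1 / p"
  proof -
    have "(\<integral>\<^sup>+x. X x * indicator A x \<partial>M) = 1"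
      using off_A[of _ 1] mean by (simp cong: nn_integral_cong)
    then show ?thesis
      by (simp add: event_expectation_def nn_integral_uniform_measure p_def)
  qed
  have "event_expectation M A (\<lambda>x. X x / (1 / p) * indicator G x) =
      (\<integral>\<^sup>+x. X x / (1 / p) * indicator G x * indicator A x \<partial>M) / p"
    by (simp add: event_expectation_def nn_integral_uniform_measure p_def)
  also have "(\<integral>\<^sup>+x. X x / (1 / p) * indicator G x * indicator A x \<partial>M) = (\<integral>\<^sup>+x. X x * indicator G x * p \<partial>M)"
  proof (rule nn_integral_cong)
    fix x assume x: "x \<in> space M"
    have "X x / (1 / p) = X x * p"
      using ennreal_times_divide[of "X x" 1 "1 / p"] by simp
    then show "X x / (1 / p) * indicator G x * indicator A x = X x * indicator G x * p"
      using off_A[OF x, of "p * indicator G x"] by (simp add: ac_simps)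
  qed
  also have "\<dots> = (\<integral>\<^sup>+x. X x * indicator G x \<partial>M) * p"
    by (rule nn_integral_multc) measurable
  also have "\<dots> / p = (\<integral>\<^sup>+x. X x * indicator G x \<partial>M)"
    using \<open>p \<noteq> 0\<close> \<open>p < \<infinity>\<close> by (intro ennreal_mult_divide_eq) auto
  finally show ?thesis unfolding expect .
qed

theorem theorem2p12:
  fixes M :: "'w measure"
    and \<theta> :: "real ^ 'd \<Rightarrow> 'w \<Rightarrow> 'w"
    and \<Phi> :: "'w \<Rightarrow> (real ^ 'd) measure"
    and B :: "(real ^ 'd) set"
    and f :: "(real ^ 'd) measure \<Rightarrow> real ^ 'd"
    and P0 :: "(real ^ 'd) measure measure"
    and m :: "nat \<Rightarrow> (real ^ 'd) measure \<Rightarrow> ennreal"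
  assumes "stationary_point_process M \<theta> \<Phi>"
    and "simple_process M \<Phi>"
    and "0 < intensity M \<Phi>" and "intensity M \<Phi> < \<infinity>"
    and "B \<in> sets borel" and "0 < emeasure lborel B" and "emeasure lborel B < \<infinity>"
    and "P0 = palm_distribution M \<theta> \<Phi> B"
    and "point_map f"
    and "\<And>n \<phi>. m n \<phi> = preimage_mass f n \<phi> 0"
  shows "(\<forall>n. AE \<phi> in P0. m n \<phi> < \<infinity>) \<and>
    (\<forall>Q. has_point_map_probability f P0 Q \<longrightarrow>
      (\<forall>G\<in>sets counting_borel0.
        (\<lambda>n. emeasure (image_palm f P0 n) G) \<longlonglongrightarrow> emeasure Q G \<longrightarrow>
        (\<lambda>n. event_expectation P0 {\<phi>\<in>counting_measures0. m n \<phi> > 0}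
           (\<lambda>\<phi>. m n \<phi> / event_expectation P0 {\<phi>\<in>counting_measures0. m n \<phi> > 0} (m n)
                 * indicator G \<phi>))
        \<longlonglongrightarrow> emeasure Q G))"
proof -
  interpret nondegenerate_process M \<theta> \<Phi> B
    using assms by (intro nondegenerate_process.intro nondegenerate_process_axioms.intro) simp_all
  have m: "m = (\<lambda>n \<phi>. preimage_mass f n \<phi> 0)"
    using assms(10) by blast
  have m_measurable: "m n \<in> borel_measurable P0" for n
    unfolding m assms(8) by (rule measurable_preimage_mass[OF assms(2,9)])
  have m_mean: "(\<integral>\<^sup>+\<phi>. m n \<phi> \<partial>P0) = 1" for n
    unfolding m assms(8) by (rule nn_integral_preimage_mass[OF assms(2,9)])
  have "event_expectation P0 {\<phi>\<in>counting_measures0. m n \<phi> > 0}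
      (\<lambda>\<phi>. m n \<phi> / event_expectation P0 {\<phi>\<in>counting_measures0. m n \<phi> > 0} (m n) * indicator G \<phi>) =
      emeasure (image_palm f P0 n) G" if G: "G \<in> sets counting_borel0" for G n
  proof -
    have "event_expectation P0 {\<phi>\<in>counting_measures0. m n \<phi> > 0}
        (\<lambda>\<phi>. m n \<phi> / event_expectation P0 {\<phi>\<in>counting_measures0. m n \<phi> > 0} (m n) * indicator G \<phi>) =
        (\<integral>\<^sup>+\<phi>. m n \<phi> * indicator G \<phi> \<partial>P0)"
      by (rule size_biased_event_expectation[OF _ m_measurable _ m_mean])
        (simp_all add: assms(8) prob_space_palm sets_palm space_palm G)
    then show ?thesis
      unfolding m assms(8) preimage_mass_eq_image_palm[OF assms(2,9) G] .
  qed
  moreover have "AE \<phi> in P0. m n \<phi> < \<infinity>" for n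
    using nn_integral_noteq_infinite[OF m_measurable, of n] by (simp add: m_mean less_top)
  ultimately show ?thesis by simp
qed

end
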